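(* Let $\rho>0$, let $T$ and $T'$ be two $\rho$-contractions in $B(\mathcal H)$ and let $c\ge1$. The following statements are equivalent: (i) $T\overset{H}{\underset c\prec}T'$; (ii) $Q_\rho(rT,U)\le c^2Q_\rho(rT',U)$ for any $r\in[0,1)$; (iii) $K_\rho(z,T)\le c^2K_\rho(z,T')$ for any $z\in\mathbb D$.
   Context: Let $\mathcal H$ be a complex Hilbert space, $\mathcal K$ an infinite-dimensional Hilbert space, $\mathbb D$ the open unit disc. $T\in B(\mathcal H)$ is a $\rho$-contraction (i.e. $T\in\mathcal C_\rho$ with $n=1$) if there exist a Hilbert space $\mathcal G\supseteq\mathcal H$ and an isometry $V\in B(\mathcal G)$ with $T^k=\rho P_{\mathcal H}V^k|_{\mathcal H}$ for all $k\ge1$. Harnack domination ($n=1$): $T\overset{H}{\underset c\prec}T'$ means $\Re p(T)+(\rho-1)\Re p(0)\le c^2[\Re p(T')+(\rho-1)\Re p(0)]$ for every polynomial with matrix coefficients $p\in\mathbb C[X]\otimes M_m$, $m\in\mathbb N$, such that $\Re p(X):=\frac12(p(X)^*+p(X))\ge0$ for all $X\in B(\mathcal K)$ with $\|X\|<1$; here $p(T)=\sum_kT^k\otimes M_k$ for $p=\sum_kX^k\otimes M_k$. $U$ is the unilateral shift on the Hardy space $H^2(\mathbb T)$. For a $\rho$-contraction $Y$ and $r\in[0,1)$, $$Q_\rho(rY,U):=\sum_{k=1}^\infty r^k{Y^*}^k\otimes U^k+\rho I\otimes I+\sum_{k=1}^\infty r^kY^k\otimes{U^*}^k,$$ and for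 $z\in\mathbb D$, $$K_\rho(z,Y):=\sum_{k=1}^\infty z^k{Y^*}^k+\rho I+\sum_{k=1}^\infty\bar z^kY^k,$$ with convergence in operator norm. *)

theory Defs
  imports "HOL-Analysis.Analysis" "Jordan_Normal_Form.Matrix"
begin

section \<open>Complex Hilbert spaces\<close>

class scaleC =
  fixes scaleC :: "complex \<Rightarrow> 'a \<Rightarrow> 'a" (infixr "*\<^sub>C" 75)

text \<open>The inner product is linear in the first argument; its real part is the real inner product,
  so norm and topology are those of \<^class>\<open>real_inner\<close>.\<close>

class complex_inner = real_inner + scaleC +
  fixes cinner :: "'a \<Rightarrow> 'a \<Rightarrow> complex"
  assumes scaleC_add_right: "a *\<^sub>C (x + y) = a *\<^sub>C x + a *\<^sub>C y"
    and scaleC_add_left: "(a + b) *\<^sub>C x = a *\<^sub>C x + b *\<^sub>C x"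
    and scaleC_scaleC: "a *\<^sub>C b *\<^sub>C x = (a * b) *\<^sub>C x"
    and scaleC_of_real: "complex_of_real r *\<^sub>C x = r *\<^sub>R x"
    and cinner_commute: "cinner x y = cnj (cinner y x)"
    and cinner_add_left: "cinner (x + y) z = cinner x z + cinner y z"
    and cinner_scaleC_left: "cinner (a *\<^sub>C x) y = a * cinner x y"
    and Re_cinner: "Re (cinner x y) = inner x y"

class chilbert_space = complex_inner + banach

lemma scaleC_one: "1 *\<^sub>C x = (x :: 'a :: complex_inner)"
  using scaleC_of_real[of 1 x] by simp

lemma cinner_self: "cinner x x = complex_of_real ((norm (x :: 'a :: complex_inner))\<^sup>2)"
proof -
  have "Im (cinner x x) = 0"
    using arg_cong[OF cinner_commute[of x x], of Im] by simp
  thus ?thesis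
    by (simp add: complex_eq_iff Re_cinner power2_norm_eq_inner)
qed

lemma cinner_scaleC_right: "cinner x (a *\<^sub>C y) = cnj a * cinner x (y :: 'a :: complex_inner)"
  by (metis cinner_commute cinner_scaleC_left complex_cnj_mult)

lemma norm_scaleC: "norm (a *\<^sub>C x) = cmod a * norm (x :: 'a :: complex_inner)"
proof -
  have "complex_of_real ((norm (a *\<^sub>C x))\<^sup>2) = a * cnj a * complex_of_real ((norm x)\<^sup>2)"
    by (simp only: cinner_self[symmetric] cinner_scaleC_left cinner_scaleC_right mult_ac)
  also have "\<dots> = complex_of_real ((cmod a * norm x)\<^sup>2)"
    by (simp only: complex_norm_square[symmetric] power_mult_distrib of_real_mult)
  finally have "(norm (a *\<^sub>C x))\<^sup>2 = (cmod a * norm x)\<^sup>2"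
    using of_real_eq_iff by blast
  thus ?thesis by (simp add: power2_eq_iff_nonneg)
qed

lemma scaleC_scaleR: "a *\<^sub>C r *\<^sub>R x = r *\<^sub>R a *\<^sub>C (x :: 'a :: complex_inner)"
  by (simp add: scaleC_of_real[symmetric] scaleC_scaleC mult.commute)

lemma bounded_linear_scaleC: "bounded_linear ((*\<^sub>C) a :: 'a :: complex_inner \<Rightarrow> 'a)"
  by (rule bounded_linear_intro[where K="cmod a"])
     (auto simp: scaleC_add_right scaleC_scaleR norm_scaleC)

lemma norm_cinner_le: "cmod (cinner x y) \<le> 2 * (norm x * norm (y :: 'a :: complex_inner))"
proof -
  have i: "Im (cinner x y) = inner (- \<i> *\<^sub>C x) y"
    by (simp add: Re_cinner[symmetric] cinner_scaleC_left)
  have "\<bar>Re (cinner x y)\<bar> \<le> norm x * norm y"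
    by (simp add: Re_cinner Cauchy_Schwarz_ineq2)
  moreover have "\<bar>Im (cinner x y)\<bar> \<le> norm x * norm y"
    unfolding i using Cauchy_Schwarz_ineq2[of "- \<i> *\<^sub>C x" y] by (simp add: norm_scaleC)
  ultimately show ?thesis
    using cmod_le[of "cinner x y"] by linarith
qed

instantiation complex :: chilbert_space
begin
definition scaleC_complex :: "complex \<Rightarrow> complex \<Rightarrow> complex" where "scaleC_complex a x = a * x"
definition cinner_complex :: "complex \<Rightarrow> complex \<Rightarrow> complex" where "cinner_complex x y = x * cnj y"
instance
  by standard (auto simp: scaleC_complex_def cinner_complex_def algebra_simps scaleR_conv_of_real
      inner_complex_def)
end

definition infinite_dimensional :: "'k::chilbert_space itself \<Rightarrow> bool" where
  "infinite_dimensional _ \<longleftrightarrow>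
     (\<forall>B::'k set. finite B \<longrightarrow> Modules.module.span ((*\<^sub>C) :: complex \<Rightarrow> 'k \<Rightarrow> 'k) B \<noteq> UNIV)"

lemma module_scaleC: "Modules.module ((*\<^sub>C) :: complex \<Rightarrow> 'k \<Rightarrow> 'k::complex_inner)"
  by standard (auto simp: scaleC_add_right scaleC_add_left scaleC_scaleC scaleC_one)


section \<open>Operators\<close>

text \<open>\<^typ>\<open>'a \<Rightarrow>\<^sub>L 'b\<close> consists of the bounded real-linear maps; the operators between complex Hilbert
  spaces are those among them that are complex-linear.\<close>

definition clinear_op :: "('a::complex_inner \<Rightarrow>\<^sub>L 'b::complex_inner) \<Rightarrow> bool" where
  "clinear_op A \<longleftrightarrow> (\<forall>a x. blinfun_apply A (a *\<^sub>C x) = a *\<^sub>C blinfun_apply A x)"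

instantiation blinfun :: (real_normed_vector, complex_inner) scaleC
begin
lift_definition scaleC_blinfun :: "complex \<Rightarrow> ('a \<Rightarrow>\<^sub>L 'b) \<Rightarrow> ('a \<Rightarrow>\<^sub>L 'b)" is "\<lambda>a f x. a *\<^sub>C f x"
  by (rule bounded_linear_compose[OF bounded_linear_scaleC])
instance ..
end

primrec op_pow :: "('a::real_normed_vector \<Rightarrow>\<^sub>L 'a) \<Rightarrow> nat \<Rightarrow> ('a \<Rightarrow>\<^sub>L 'a)" where
  "op_pow A 0 = id_blinfun"
| "op_pow A (Suc k) = A o\<^sub>L op_pow A k"

definition adj :: "('a::chilbert_space \<Rightarrow>\<^sub>L 'b::chilbert_space) \<Rightarrow> ('b \<Rightarrow>\<^sub>L 'a)" where
  "adj A = (THE B. \<forall>x y. cinner (blinfun_apply A x) y = cinner x (blinfun_apply B y))"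

definition isometry_op :: "('a::chilbert_space \<Rightarrow>\<^sub>L 'b::chilbert_space) \<Rightarrow> bool" where
  "isometry_op V \<longleftrightarrow> clinear_op V \<and> (\<forall>x. norm (blinfun_apply V x) = norm x)"

definition op_pos :: "('a::chilbert_space \<Rightarrow>\<^sub>L 'a) \<Rightarrow> bool" where
  "op_pos A \<longleftrightarrow> (\<forall>x. cinner (blinfun_apply A x) x \<in> \<real>\<^sub>\<ge>\<^sub>0)"

definition op_le :: "('a::chilbert_space \<Rightarrow>\<^sub>L 'a) \<Rightarrow> ('a \<Rightarrow>\<^sub>L 'a) \<Rightarrow> bool" where
  "op_le A B \<longleftrightarrow> op_pos (B - A)"

text \<open>The space containing \<open>'a\<close> is a Hilbert space \<open>'g\<close> with an isometric embedding \<open>J\<close> of \<open>'a\<close>; under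
  this identification \<open>J\<close> is the inclusion and \<open>adj J\<close> is the orthogonal projection of \<open>'g\<close> onto
  \<open>'a\<close>. HOL cannot quantify over types inside a formula, so the type of the larger space is an
  argument; a type variable \<open>'g\<close> occurring only in a hypothesis
  \<open>rho_contraction TYPE('g) \<rho> T\<close> of a theorem amounts to an existential quantification over all
  Hilbert spaces in that hypothesis.\<close>

definition rho_contraction ::
  "'g::chilbert_space itself \<Rightarrow> real \<Rightarrow> ('a::chilbert_space \<Rightarrow>\<^sub>L 'a) \<Rightarrow> bool" where
  "rho_contraction _ \<rho> T \<longleftrightarrow> clinear_op T \<and>
     (\<exists>(J :: 'a \<Rightarrow>\<^sub>L 'g) (V :: 'g \<Rightarrow>\<^sub>L 'g). isometry_op J \<and> isometry_op V \<and>
        (\<forall>k\<ge>1. op_pow T k = \<rho> *\<^sub>R (adj J o\<^sub>L op_pow V k o\<^sub>L J)))"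


section \<open>Matrices of operators\<close>

text \<open>Operators on the tensor product of \<open>'a\<close> with the \<open>m\<close>-dimensional space are \<open>m \<times> m\<close> matrices
  of operators acting on the \<open>m\<close>-fold direct sum of \<open>'a\<close>; the tensor product of \<open>T\<close> with a scalar
  matrix \<open>M\<close> has the entries \<open>M $$ (i, j) *\<^sub>C T\<close>.\<close>

definition block_adj :: "('a::chilbert_space \<Rightarrow>\<^sub>L 'a) mat \<Rightarrow> ('a \<Rightarrow>\<^sub>L 'a) mat" where
  "block_adj A = mat (dim_col A) (dim_row A) (\<lambda>(i, j). adj (A $$ (j, i)))"

definition block_scaleR :: "real \<Rightarrow> ('a::chilbert_space \<Rightarrow>\<^sub>L 'a) mat \<Rightarrow> ('a \<Rightarrow>\<^sub>L 'a) mat" where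
  "block_scaleR r A = map_mat ((*\<^sub>R) r) A"

definition block_Re :: "('a::chilbert_space \<Rightarrow>\<^sub>L 'a) mat \<Rightarrow> ('a \<Rightarrow>\<^sub>L 'a) mat" where
  "block_Re A = block_scaleR (1/2) (block_adj A + A)"

definition block_pos :: "('a::chilbert_space \<Rightarrow>\<^sub>L 'a) mat \<Rightarrow> bool" where
  "block_pos A \<longleftrightarrow> (\<forall>x :: nat \<Rightarrow> 'a.
     (\<Sum>i<dim_row A. \<Sum>j<dim_col A. cinner (blinfun_apply (A $$ (i, j)) (x j)) (x i)) \<in> \<real>\<^sub>\<ge>\<^sub>0)"

definition block_le :: "('a::chilbert_space \<Rightarrow>\<^sub>L 'a) mat \<Rightarrow> ('a \<Rightarrow>\<^sub>L 'a) mat \<Rightarrow> bool" where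
  "block_le A B \<longleftrightarrow> block_pos (B - A)"

text \<open>A polynomial with matrix coefficients is given by a degree bound \<open>d\<close> and coefficients
  \<open>M 0, \<dots>, M d\<close>; \<open>mpoly_op m d M T\<close> is its value, the sum over \<open>k \<le> d\<close> of \<open>T^k\<close> tensor \<open>M k\<close>.\<close>

definition mpoly_op ::
  "nat \<Rightarrow> nat \<Rightarrow> (nat \<Rightarrow> complex mat) \<Rightarrow> ('a::chilbert_space \<Rightarrow>\<^sub>L 'a) \<Rightarrow> ('a \<Rightarrow>\<^sub>L 'a) mat" where
  "mpoly_op m d M T = mat m m (\<lambda>(i, j). \<Sum>k\<le>d. (M k $$ (i, j)) *\<^sub>C op_pow T k)"

definition Re_pos_mpoly ::
  "'k::chilbert_space itself \<Rightarrow> nat \<Rightarrow> nat \<Rightarrow> (nat \<Rightarrow> complex mat) \<Rightarrow> bool" where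
  "Re_pos_mpoly _ m d M \<longleftrightarrow> (\<forall>X :: 'k \<Rightarrow>\<^sub>L 'k. clinear_op X \<and> norm X < 1 \<longrightarrow>
     block_pos (block_Re (mpoly_op m d M X)))"

definition harnack_dominated :: "'k::chilbert_space itself \<Rightarrow> real \<Rightarrow> real \<Rightarrow>
    ('a::chilbert_space \<Rightarrow>\<^sub>L 'a) \<Rightarrow> ('a \<Rightarrow>\<^sub>L 'a) \<Rightarrow> bool" where
  "harnack_dominated K \<rho> c T T' \<longleftrightarrow>
     (\<forall>m\<ge>1. \<forall>d M. (\<forall>k\<le>d. M k \<in> carrier_mat m m) \<and> Re_pos_mpoly K m d M \<longrightarrow>
        block_le
          (block_Re (mpoly_op m d M T) + block_scaleR (\<rho> - 1) (block_Re (mpoly_op m d M 0)))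
          (block_scaleR (c\<^sup>2)
            (block_Re (mpoly_op m d M T') + block_scaleR (\<rho> - 1) (block_Re (mpoly_op m d M 0)))))"


section \<open>Hardy spaces\<close>

text \<open>The Hardy space of the circle with values in \<open>'a\<close>: a function is represented by the square
  summable sequence of its Fourier coefficients, those of negative index being zero, and the norm is
  given by Parseval's formula. The scalar Hardy space is \<open>complex hardy\<close>.\<close>

typedef (overloaded) ('a::real_normed_vector) hardy =
  "{f :: nat \<Rightarrow> 'a. summable (\<lambda>n. (norm (f n))\<^sup>2)}"
  morphisms fourier Hardy
  by (rule exI[of _ "\<lambda>_. 0"]) simp

setup_lifting type_definition_hardy

lemma square_summable_add:
  fixes f g :: "nat \<Rightarrow> 'a::real_normed_vector"
  assumes "summable (\<lambda>n. (norm (f n))\<^sup>2)" "summable (\<lambda>n. (norm (g n))\<^sup>2)"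
  shows "summable (\<lambda>n. (norm (f n + g n))\<^sup>2)"
proof (rule summable_comparison_test')
  show "summable (\<lambda>n. 2 * (norm (f n))\<^sup>2 + 2 * (norm (g n))\<^sup>2)"
    by (intro summable_add summable_mult assms)
  fix n :: nat
  have "(norm (f n + g n))\<^sup>2 \<le> (norm (f n) + norm (g n))\<^sup>2"
    by (simp add: norm_triangle_ineq power_mono)
  also have "\<dots> \<le> 2 * (norm (f n))\<^sup>2 + 2 * (norm (g n))\<^sup>2"
    using sum_squares_bound[of "norm (f n)" "norm (g n)"] by (simp add: power2_sum)
  finally show "norm ((norm (f n + g n))\<^sup>2) \<le> 2 * (norm (f n))\<^sup>2 + 2 * (norm (g n))\<^sup>2"
    by simp
qed

lemma square_summable_mult:
  fixes f g :: "nat \<Rightarrow> 'a::real_normed_vector"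
  assumes "summable (\<lambda>n. (norm (f n))\<^sup>2)" "summable (\<lambda>n. (norm (g n))\<^sup>2)"
  shows "summable (\<lambda>n. 2 * (norm (f n) * norm (g n)))"
proof (rule summable_comparison_test')
  show "summable (\<lambda>n. (norm (f n))\<^sup>2 + (norm (g n))\<^sup>2)"
    by (intro summable_add assms)
  show "norm (2 * (norm (f n) * norm (g n))) \<le> (norm (f n))\<^sup>2 + (norm (g n))\<^sup>2" for n
    using sum_squares_bound[of "norm (f n)" "norm (g n)"] by (simp add: mult.assoc)
qed

lemma summable_inner:
  fixes f g :: "nat \<Rightarrow> 'a::real_inner"
  assumes "summable (\<lambda>n. (norm (f n))\<^sup>2)" "summable (\<lambda>n. (norm (g n))\<^sup>2)"
  shows "summable (\<lambda>n. inner (f n) (g n))"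
proof (rule summable_comparison_test'[OF square_summable_mult[OF assms]])
  show "norm (inner (f n) (g n)) \<le> 2 * (norm (f n) * norm (g n))" for n
    using Cauchy_Schwarz_ineq2[of "f n" "g n"] mult_nonneg_nonneg[of "norm (f n)" "norm (g n)"]
    unfolding real_norm_def by (smt (verit) norm_ge_zero)
qed

lemma summable_cinner:
  fixes f g :: "nat \<Rightarrow> 'a::complex_inner"
  assumes "summable (\<lambda>n. (norm (f n))\<^sup>2)" "summable (\<lambda>n. (norm (g n))\<^sup>2)"
  shows "summable (\<lambda>n. cinner (f n) (g n))"
  by (rule summable_comparison_test'[OF square_summable_mult[OF assms]]) (rule norm_cinner_le)

lemma summable_norm_coeff: "summable (\<lambda>n. (norm (fourier f n))\<^sup>2)"
  using fourier[of f] by simp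

instantiation hardy :: (real_normed_vector) real_vector
begin
lift_definition zero_hardy :: "'a hardy" is "\<lambda>_. 0" by simp
lift_definition plus_hardy :: "'a hardy \<Rightarrow> 'a hardy \<Rightarrow> 'a hardy" is "\<lambda>f g n. f n + g n"
  by (rule square_summable_add)
lift_definition uminus_hardy :: "'a hardy \<Rightarrow> 'a hardy" is "\<lambda>f n. - f n" by simp
lift_definition minus_hardy :: "'a hardy \<Rightarrow> 'a hardy \<Rightarrow> 'a hardy" is "\<lambda>f g n. f n - g n"
  subgoal for f g using square_summable_add[of f "\<lambda>n. - g n"] by simp
  done
lift_definition scaleR_hardy :: "real \<Rightarrow> 'a hardy \<Rightarrow> 'a hardy" is "\<lambda>r f n. r *\<^sub>R f n"
  by (simp add: power_mult_distrib summable_mult)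
instance
  by standard (transfer; simp add: algebra_simps)+
end

instantiation hardy :: (complex_inner) complex_inner
begin
lift_definition scaleC_hardy :: "complex \<Rightarrow> 'a hardy \<Rightarrow> 'a hardy" is "\<lambda>a f n. a *\<^sub>C f n"
  by (simp add: norm_scaleC power_mult_distrib summable_mult)
lift_definition inner_hardy :: "'a hardy \<Rightarrow> 'a hardy \<Rightarrow> real" is "\<lambda>f g. \<Sum>n. inner (f n) (g n)" .
lift_definition cinner_hardy :: "'a hardy \<Rightarrow> 'a hardy \<Rightarrow> complex" is "\<lambda>f g. \<Sum>n. cinner (f n) (g n)" .
definition norm_hardy :: "'a hardy \<Rightarrow> real" where "norm_hardy f = sqrt (inner f f)"
definition dist_hardy :: "'a hardy \<Rightarrow> 'a hardy \<Rightarrow> real" where "dist_hardy f g = norm (f - g)"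
definition sgn_hardy :: "'a hardy \<Rightarrow> 'a hardy" where "sgn_hardy f = f /\<^sub>R norm f"
definition uniformity_hardy :: "('a hardy \<times> 'a hardy) filter" where
  "uniformity_hardy = (INF e\<in>{0 <..}. principal {(x, y). dist x y < e})"
definition open_hardy :: "'a hardy set \<Rightarrow> bool" where
  "open_hardy S \<longleftrightarrow> (\<forall>x\<in>S. \<forall>\<^sub>F (x', y) in uniformity. x' = x \<longrightarrow> y \<in> S)"
instance
proof
  fix f g h :: "'a hardy" and a b :: complex and r :: real
  show "sgn f = f /\<^sub>R norm f" by (rule sgn_hardy_def)
  show "dist f g = norm (f - g)" by (rule dist_hardy_def)
  show "uniformity = (INF e\<in>{0 <..}. principal {(x, y :: 'a hardy). dist x y < e})"
    by (rule uniformity_hardy_def)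
  show "open S \<longleftrightarrow> (\<forall>x\<in>S. \<forall>\<^sub>F (x', y) in uniformity. x' = x \<longrightarrow> y \<in> S)" for S :: "'a hardy set"
    by (rule open_hardy_def)
  show "norm f = sqrt (inner f f)" by (rule norm_hardy_def)
  show "inner f g = inner g f" by transfer (simp add: inner_commute)
  show "inner (f + g) h = inner f h + inner g h"
    by transfer (simp add: inner_add_left suminf_add summable_inner)
  show "inner (r *\<^sub>R f) g = r * inner f g"
    by transfer (simp add: suminf_mult summable_inner)
  show "0 \<le> inner f f"
    by transfer (intro suminf_nonneg summable_inner, auto)
  show "inner f f = 0 \<longleftrightarrow> f = 0"
  proof transfer
    fix f :: "nat \<Rightarrow> 'a" assume f: "summable (\<lambda>n. (norm (f n))\<^sup>2)"
    show "(\<Sum>n. inner (f n) (f n)) = 0 \<longleftrightarrow> f = (\<lambda>_. 0)"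
      using suminf_eq_zero_iff[OF summable_inner[OF f f]] by auto
  qed
  show "a *\<^sub>C (f + g) = a *\<^sub>C f + a *\<^sub>C g" by transfer (simp add: scaleC_add_right)
  show "(a + b) *\<^sub>C f = a *\<^sub>C f + b *\<^sub>C f" by transfer (simp add: scaleC_add_left)
  show "a *\<^sub>C b *\<^sub>C f = (a * b) *\<^sub>C f" by transfer (simp add: scaleC_scaleC)
  show "complex_of_real r *\<^sub>C f = r *\<^sub>R f" by transfer (simp add: scaleC_of_real)
  show "cinner f g = cnj (cinner g f)"
  proof transfer
    fix f g :: "nat \<Rightarrow> 'a"
    assume f: "summable (\<lambda>n. (norm (f n))\<^sup>2)" and g: "summable (\<lambda>n. (norm (g n))\<^sup>2)"
    have "(\<lambda>n. cnj (cinner (g n) (f n))) sums cnj (\<Sum>n. cinner (g n) (f n))"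
      unfolding sums_cnj by (rule summable_sums[OF summable_cinner[OF g f]])
    thus "(\<Sum>n. cinner (f n) (g n)) = cnj (\<Sum>n. cinner (g n) (f n))"
      by (simp only: cinner_commute[symmetric] sums_iff)
  qed
  show "cinner (f + g) h = cinner f h + cinner g h"
    by transfer (simp add: cinner_add_left suminf_add summable_cinner)
  show "cinner (a *\<^sub>C f) g = a * cinner f g"
    by transfer (simp add: cinner_scaleC_left suminf_mult summable_cinner)
  show "Re (cinner f g) = inner f g"
    by transfer (simp add: Re_suminf summable_cinner Re_cinner)
qed
end

lemma norm_hardy_sq: "(norm f)\<^sup>2 = (\<Sum>n. (norm (fourier f n))\<^sup>2)"
  for f :: "'a::complex_inner hardy"
  by (simp add: power2_norm_eq_inner inner_hardy.rep_eq)

lemma sum_coeff_le: "(\<Sum>n<N. (norm (fourier f n))\<^sup>2) \<le> (norm f)\<^sup>2"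
  for f :: "'a::complex_inner hardy"
  unfolding norm_hardy_sq by (rule sum_le_suminf[OF summable_norm_coeff]) auto

lemma norm_coeff_le: "norm (fourier f n) \<le> norm f" for f :: "'a::complex_inner hardy"
proof -
  have "(norm (fourier f n))\<^sup>2 \<le> (\<Sum>n<Suc n. (norm (fourier f n))\<^sup>2)"
    by (simp add: sum_nonneg)
  also have "\<dots> \<le> (norm f)\<^sup>2" by (rule sum_coeff_le)
  finally show ?thesis by (simp add: power2_le_iff_abs_le)
qed

instance hardy :: (chilbert_space) chilbert_space
proof
  fix X :: "nat \<Rightarrow> 'a hardy" assume X: "Cauchy X"
  have "Cauchy (\<lambda>k. fourier (X k) n)" for n
  proof (rule metric_CauchyI)
    fix e :: real assume "e > 0"
    then obtain M where M: "\<And>i j. i \<ge> M \<Longrightarrow> j \<ge> M \<Longrightarrow> dist (X i) (X j) < e"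
      using metric_CauchyD[OF X] by meson
    have "dist (fourier (X i) n) (fourier (X j) n) \<le> dist (X i) (X j)" for i j
      using norm_coeff_le[of "X i - X j" n] by (simp add: dist_norm minus_hardy.rep_eq)
    thus "\<exists>M. \<forall>i\<ge>M. \<forall>j\<ge>M. dist (fourier (X i) n) (fourier (X j) n) < e"
      using M by (meson le_less_trans)
  qed
  hence "\<exists>l. (\<lambda>k. fourier (X k) n) \<longlonglongrightarrow> l" for n
    using Cauchy_convergent_iff convergent_def by blast
  then obtain l where l: "\<And>n. (\<lambda>k. fourier (X k) n) \<longlonglongrightarrow> l n" by metis
  have fin: "(\<Sum>n<N. (norm (fourier (X i) n - l n))\<^sup>2) \<le> e\<^sup>2"
    if "e > 0" "\<And>j. j \<ge> M \<Longrightarrow> norm (X i - X j) < e" for e M i N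
  proof (rule tendsto_upperbound)
    show "(\<lambda>j. \<Sum>n<N. (norm (fourier (X i) n - fourier (X j) n))\<^sup>2) \<longlonglongrightarrow>
        (\<Sum>n<N. (norm (fourier (X i) n - l n))\<^sup>2)"
      by (intro tendsto_intros l)
    have "(\<Sum>n<N. (norm (fourier (X i) n - fourier (X j) n))\<^sup>2) \<le> e\<^sup>2" if "j \<ge> M" for j
    proof -
      have "(\<Sum>n<N. (norm (fourier (X i) n - fourier (X j) n))\<^sup>2) \<le> (norm (X i - X j))\<^sup>2"
        using sum_coeff_le[of "X i - X j" N] by (simp add: minus_hardy.rep_eq)
      also have "\<dots> \<le> e\<^sup>2" using \<open>\<And>j. j \<ge> M \<Longrightarrow> norm (X i - X j) < e\<close>[OF that]
        by (intro power_mono) auto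
      finally show ?thesis .
    qed
    thus "\<forall>\<^sub>F j in sequentially. (\<Sum>n<N. (norm (fourier (X i) n - fourier (X j) n))\<^sup>2) \<le> e\<^sup>2"
      using eventually_sequentially by blast
  qed simp
  have smm: "summable (\<lambda>n. (norm (fourier (X i) n - l n))\<^sup>2)"
    if "e > 0" "\<And>j. j \<ge> M \<Longrightarrow> norm (X i - X j) < e" for e M i
  proof (rule bounded_imp_summable)
    show "(\<Sum>n\<le>N. (norm (fourier (X i) n - l n))\<^sup>2) \<le> e\<^sup>2" for N
      using fin[OF that, of M "Suc N"] by (simp add: lessThan_Suc_atMost)
  qed simp
  obtain M0 where M0: "\<And>i j. i \<ge> M0 \<Longrightarrow> j \<ge> M0 \<Longrightarrow> norm (X i - X j) < 1"
    using CauchyD[OF X, of 1] by auto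
  have "summable (\<lambda>n. (norm (fourier (X M0) n - (fourier (X M0) n - l n)))\<^sup>2)"
    using square_summable_add[OF summable_norm_coeff[of "X M0"],
        of "\<lambda>n. - (fourier (X M0) n - l n)"] smm[of 1 M0 M0] M0
    by (simp add: norm_minus_commute)
  hence "summable (\<lambda>n. (norm (l n))\<^sup>2)" by simp
  then obtain L where L: "fourier L = l" using Hardy_inverse by blast
  have "X \<longlonglongrightarrow> L"
  proof (rule LIMSEQ_I)
    fix r :: real assume r: "r > 0"
    then obtain M where M: "\<And>i j. i \<ge> M \<Longrightarrow> j \<ge> M \<Longrightarrow> norm (X i - X j) < r/2"
      using CauchyD[OF X, of "r/2"] by auto
    have "norm (X i - L) < r" if "i \<ge> M" for i
    proof -
      have "(norm (X i - L))\<^sup>2 = (\<Sum>n. (norm (fourier (X i) n - l n))\<^sup>2)"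
        by (simp add: norm_hardy_sq minus_hardy.rep_eq L)
      also have "\<dots> \<le> (r/2)\<^sup>2"
        using r M[OF that] by (intro suminf_le_const smm[of "r/2" M] fin[of "r/2" M]) auto
      finally have "norm (X i - L) \<le> r/2"
        by (rule power2_le_imp_le) (use r in auto)
      thus ?thesis using r by linarith
    qed
    thus "\<exists>no. \<forall>n\<ge>no. norm (X n - L) < r" by blast
  qed
  thus "convergent X" by (rule convergentI)
qed

text \<open>The unilateral shift is multiplication by the coordinate function.\<close>

lift_definition hardy_shift :: "complex hardy \<Rightarrow> complex hardy"
  is "\<lambda>f n. case n of 0 \<Rightarrow> 0 | Suc k \<Rightarrow> f k"
  by (subst summable_Suc_iff[symmetric]) simp

lemma norm_hardy_shift: "norm (hardy_shift f) = norm f"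
proof -
  have "(norm (hardy_shift f))\<^sup>2 = (norm f)\<^sup>2"
    using suminf_split_head[OF summable_norm_coeff[of "hardy_shift f"]]
    by (simp add: norm_hardy_sq hardy_shift.rep_eq)
  thus ?thesis by simp
qed

lift_definition unilateral_shift :: "complex hardy \<Rightarrow>\<^sub>L complex hardy" is hardy_shift
proof (rule bounded_linear_intro[where K=1])
  show "hardy_shift (f + g) = hardy_shift f + hardy_shift g" for f g
    by transfer (auto split: nat.splits)
  show "hardy_shift (r *\<^sub>R f) = r *\<^sub>R hardy_shift f" for r f
    by transfer (auto split: nat.splits)
qed (simp add: norm_hardy_shift)


section \<open>Tensor product with the scalar Hardy space\<close>

text \<open>The Hilbert space tensor product of \<open>'a\<close> and \<open>complex hardy\<close> is \<open>'a hardy\<close>: the next two lemmas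
  are the two properties which determine the tensor product up to unitary equivalence.\<close>

lift_definition hardy_tensor :: "'a::complex_inner \<Rightarrow> complex hardy \<Rightarrow> 'a hardy"
  is "\<lambda>x h n. h n *\<^sub>C x"
  by (simp add: norm_scaleC power_mult_distrib summable_mult2)

lemma cinner_hardy_tensor:
  "cinner (hardy_tensor x h) (hardy_tensor y g) = cinner x y * cinner h g"
proof transfer
  fix x y :: 'a and h g :: "nat \<Rightarrow> complex"
  assume "summable (\<lambda>n. (norm (h n))\<^sup>2)" "summable (\<lambda>n. (norm (g n))\<^sup>2)"
  note s = summable_cinner[OF this]
  have "(\<Sum>n. cinner (h n *\<^sub>C x) (g n *\<^sub>C y)) = (\<Sum>n. cinner x y * cinner (h n) (g n))"
    by (simp add: cinner_scaleC_left cinner_scaleC_right cinner_complex_def mult_ac)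
  also have "\<dots> = cinner x y * (\<Sum>n. cinner (h n) (g n))"
    by (rule suminf_mult[OF s])
  finally show "(\<Sum>n. cinner (h n *\<^sub>C x) (g n *\<^sub>C y)) = cinner x y * (\<Sum>n. cinner (h n) (g n))" .
qed

lemma hardy_tensor_total:
  "closure (span {hardy_tensor x h |x h. True}) = (UNIV :: 'a::complex_inner hardy set)"
proof -
  have "f \<in> closure (span {hardy_tensor x h |x h. True})" for f :: "'a hardy"
  proof -
    define e where "e = (\<lambda>k. Hardy (\<lambda>n. if n = k then 1 else 0 :: complex))"
    have e: "fourier (e k) n = (if n = k then 1 else 0)" for k n
    proof -
      have "summable (\<lambda>n. (norm (if n = k then 1 else 0 :: complex))\<^sup>2)"
        by (rule summable_finite[of "{k}"]) auto
      thus ?thesis unfolding e_def by (simp add: Hardy_inverse)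
    qed
    define s where "s = (\<lambda>N. \<Sum>k<N. hardy_tensor (fourier f k) (e k))"
    have sp: "s N \<in> span {hardy_tensor x h |x h. True}" for N
      unfolding s_def by (intro span_sum span_base) blast
    have c: "fourier (s N) n = (if n < N then fourier f n else 0)" for N n
    proof (induction N)
      case 0 thus ?case by (simp add: s_def zero_hardy.rep_eq)
    next
      case (Suc N)
      have "fourier (s (Suc N)) n = fourier (s N) n + (if n = N then 1 else 0) *\<^sub>C fourier f N"
        by (simp add: s_def plus_hardy.rep_eq hardy_tensor.rep_eq e)
      thus ?case
        using Suc scaleC_of_real[of 0 "fourier f N"] by (auto simp: scaleC_one less_Suc_eq)
    qed
    have "(\<lambda>N. (norm (f - s N))\<^sup>2) \<longlonglongrightarrow> 0"
    proof -
      have "(norm (f - s N))\<^sup>2 = (norm f)\<^sup>2 - (\<Sum>n<N. (norm (fourier f n))\<^sup>2)" for N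
      proof -
        have eq: "(norm (fourier (f - s N) n))\<^sup>2 =
            (norm (fourier f n))\<^sup>2 - (if n \<in> {..<N} then (norm (fourier f n))\<^sup>2 else 0)" for n
          by (simp add: minus_hardy.rep_eq c)
        have "(\<lambda>n. if n \<in> {..<N} then (norm (fourier f n))\<^sup>2 else 0) sums
            (\<Sum>n<N. (norm (fourier f n))\<^sup>2)"
          by (rule sums_If_finite_set) simp
        from sums_diff[OF summable_sums[OF summable_norm_coeff[of f]] this] show ?thesis
          unfolding norm_hardy_sq eq by (rule sums_unique[symmetric])
      qed
      moreover have "(\<lambda>N. \<Sum>n<N. (norm (fourier f n))\<^sup>2) \<longlonglongrightarrow> (norm f)\<^sup>2"
        unfolding norm_hardy_sq by (rule summable_LIMSEQ[OF summable_norm_coeff])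
      ultimately show ?thesis
        using tendsto_diff[OF tendsto_const[of "(norm f)\<^sup>2"],
            of "\<lambda>N. \<Sum>n<N. (norm (fourier f n))\<^sup>2" "(norm f)\<^sup>2" sequentially] by simp
    qed
    hence "(\<lambda>N. sqrt ((norm (f - s N))\<^sup>2)) \<longlonglongrightarrow> sqrt 0" by (rule tendsto_real_sqrt)
    hence "(\<lambda>N. norm (s N - f)) \<longlonglongrightarrow> 0" by (simp add: norm_minus_commute)
    hence "s \<longlonglongrightarrow> f" by (rule LIM_zero_cancel[OF tendsto_norm_zero_cancel])
    thus ?thesis unfolding closure_sequential using sp by (intro exI[of _ s]) simp
  qed
  thus ?thesis by blast
qed

definition tensor_op :: "('a::chilbert_space \<Rightarrow>\<^sub>L 'a) \<Rightarrow> (complex hardy \<Rightarrow>\<^sub>L complex hardy) \<Rightarrow>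
    ('a hardy \<Rightarrow>\<^sub>L 'a hardy)" where
  "tensor_op A S = (THE B. \<forall>x h. blinfun_apply B (hardy_tensor x h) =
     hardy_tensor (blinfun_apply A x) (blinfun_apply S h))"


section \<open>The operator kernels\<close>

definition Q_kernel :: "real \<Rightarrow> real \<Rightarrow> ('a::chilbert_space \<Rightarrow>\<^sub>L 'a) \<Rightarrow> ('a hardy \<Rightarrow>\<^sub>L 'a hardy)" where
  "Q_kernel \<rho> r Y =
     (\<Sum>k. r ^ Suc k *\<^sub>R tensor_op (op_pow (adj Y) (Suc k)) (op_pow unilateral_shift (Suc k)))
     + \<rho> *\<^sub>R tensor_op id_blinfun id_blinfun
     + (\<Sum>k. r ^ Suc k *\<^sub>R tensor_op (op_pow Y (Suc k)) (op_pow (adj unilateral_shift) (Suc k)))"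

definition K_kernel :: "real \<Rightarrow> complex \<Rightarrow> ('a::chilbert_space \<Rightarrow>\<^sub>L 'a) \<Rightarrow> ('a \<Rightarrow>\<^sub>L 'a)" where
  "K_kernel \<rho> z Y =
     (\<Sum>k. (z ^ Suc k) *\<^sub>C op_pow (adj Y) (Suc k))
     + \<rho> *\<^sub>R id_blinfun
     + (\<Sum>k. (cnj z ^ Suc k) *\<^sub>C op_pow Y (Suc k))"

end

theory Submission
  imports Defs
begin

text \<open>All that is used of a \<open>\<rho>\<close>-contraction is that its powers are bounded. The operators
  \<open>K(r \<zeta>, Y)\<close> are then the values at \<open>\<zeta>\<close> of an absolutely convergent Fourier series on the
  circle, and \<open>Q(r Y, U)\<close> is the Toeplitz operator with that symbol. Put
  \<open>D = c\<^sup>2 K(\<cdot>, T') - K(\<cdot>, T)\<close>.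
  If \<open>D \<ge> 0\<close>, then integrating \<open>\<langle>D(r \<zeta>) F(\<zeta>), F(\<zeta>)\<rangle>\<close> over the circle for vector polynomials
  \<open>F\<close> gives the inequality of the Toeplitz operators; conversely the Toeplitz form at \<open>x\<close> tensor a
  Szego kernel is a positive multiple of \<open>\<langle>D(z) x, x\<rangle>\<close>.
  If \<open>D \<ge> 0\<close> and \<open>Re p \<ge> 0\<close>, then the Schur product of the positive matrices
  \<open>Re p(r \<zeta>)\<close> and \<open>\<langle>D(r \<zeta>) x\<^sub>j, x\<^sub>i\<rangle>\<close> has a nonnegative sum of entries; its mean over the circle
  tends to the Harnack inequality for \<open>p\<close> as \<open>r \<rightarrow> 1\<close>. Conversely, \<open>D(z) \<ge> 0\<close> is the limit of the
  Harnack inequalities for slightly shifted partial sums of \<open>1 + 2 \<Sum> cnj z^k X^k\<close>.\<close>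


section \<open>Adjoints\<close>

lemma norm_add_sq: "(norm (x + y))\<^sup>2 = (norm x)\<^sup>2 + 2 * inner x y + (norm y)\<^sup>2"
  for x y :: "'a::real_inner"
  by (simp add: power2_norm_eq_inner inner_add_left inner_add_right inner_commute[of y x])

text \<open>The representing vector minimizes \<open>|x|^2 - 2 \<phi> x\<close>; minimizing sequences are Cauchy by the
  parallelogram law.\<close>

lemma riesz_representation:
  fixes \<phi> :: "'a::{real_inner,banach} \<Rightarrow> real"
  assumes "bounded_linear \<phi>"
  obtains y where "\<And>x. \<phi> x = inner x y"
proof -
  interpret bounded_linear \<phi> by fact
  obtain K where K: "\<And>x. norm (\<phi> x) \<le> norm x * K"
    using bounded by blast
  define J where "J x = (norm x)\<^sup>2 - 2 * \<phi> x" for x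
  have J_ge: "J x \<ge> - K\<^sup>2" for x
    using K[of x] sum_squares_ge_zero[of "norm x - K" 0]
    by (simp add: J_def power2_eq_square algebra_simps)
  define m where "m = (INF x. J x)"
  have bdd: "bdd_below (range J)"
    using J_ge by (auto simp: bdd_below_def)
  have m_le: "m \<le> J x" for x
    unfolding m_def by (rule cINF_lower[OF bdd]) simp
  have "\<exists>x. J x < m + 1 / real (Suc n)" for n
    using cINF_less_iff[OF _ bdd, of "m + 1 / real (Suc n)"] by (auto simp: m_def)
  then obtain X where X: "\<And>n. J (X n) < m + 1 / real (Suc n)" by metis
  have dist_le: "(norm (X i - X j))\<^sup>2 \<le> 2 / real (Suc i) + 2 / real (Suc j)" for i j
  proof -
    have "J ((1/2) *\<^sub>R (X i + X j)) = (norm (X i + X j))\<^sup>2 / 4 - \<phi> (X i) - \<phi> (X j)"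
      by (simp add: J_def add scaleR power_divide add_divide_distrib)
    moreover have "(norm (X i - X j))\<^sup>2 = (norm (X i))\<^sup>2 - 2 * inner (X i) (X j) + (norm (X j))\<^sup>2"
      using norm_add_sq[of "X i" "- X j"] by simp
    ultimately have "(norm (X i - X j))\<^sup>2 = 2 * J (X i) + 2 * J (X j) - 4 * J ((1/2) *\<^sub>R (X i + X j))"
      using norm_add_sq[of "X i" "X j"] J_def[of "X i"] J_def[of "X j"]
      by argo
    thus ?thesis using X[of i] X[of j] m_le[of "(1/2) *\<^sub>R (X i + X j)"] by linarith
  qed
  have "Cauchy X"
  proof (rule CauchyI)
    fix e :: real assume e: "e > 0"
    obtain N where N: "4 / e\<^sup>2 < real N" using reals_Archimedean2 by blast
    have "norm (X i - X j) < e" if "i \<ge> N" "j \<ge> N" for i j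
    proof -
      have "real N > 0" using N e by (smt (verit) divide_pos_pos zero_less_power)
      hence "2 / real (Suc i) \<le> 2 / real N" "2 / real (Suc j) \<le> 2 / real N"
        using that by (auto intro!: divide_left_mono)
      moreover have "4 / real N < e\<^sup>2"
        using N e \<open>real N > 0\<close> by (simp add: field_simps)
      ultimately have "(norm (X i - X j))\<^sup>2 < e\<^sup>2" using dist_le[of i j] by linarith
      thus ?thesis using e by (simp add: power2_less_imp_less)
    qed
    thus "\<exists>M. \<forall>i\<ge>M. \<forall>j\<ge>M. norm (X i - X j) < e" by blast
  qed
  then obtain y where y: "X \<longlonglongrightarrow> y"
    using Cauchy_convergent_iff convergent_def by blast
  have "(\<lambda>n. J (X n)) \<longlonglongrightarrow> J y"
    unfolding J_def by (intro tendsto_intros y tendsto)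
  moreover have "(\<lambda>n. m + 1 / real (Suc n)) \<longlonglongrightarrow> m"
    using tendsto_add[OF tendsto_const LIMSEQ_inverse_real_of_nat] by (simp add: inverse_eq_divide)
  ultimately have J_y: "J y \<le> m"
    using X by (intro LIMSEQ_le) (auto intro: less_imp_le)
  have "\<phi> x = inner x y" for x
  proof -
    define d where "d = inner x y - \<phi> x"
    \<comment> \<open>First variation: the minimizer \<open>y\<close> is perturbed by
      \<open>t *\<^sub>R x\<close>, and \<open>2 * d\<close> is the slope at
      \<open>t = 0\<close>.\<close>
    have q: "0 \<le> t\<^sup>2 * (norm x)\<^sup>2 + 2 * t * d" for t
    proof -
      have "J (y + t *\<^sub>R x) = J y + (t\<^sup>2 * (norm x)\<^sup>2 + 2 * t * d)"
        using norm_add_sq[of y "t *\<^sub>R x"]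
        by (simp add: J_def d_def add scaleR inner_commute[of y x] power_mult_distrib
            right_diff_distrib)
      thus ?thesis using m_le[of "y + t *\<^sub>R x"] J_y by linarith
    qed
    have "d = 0"
    proof (rule ccontr)
      assume "d \<noteq> 0"
      let ?s = "1 + (norm x)\<^sup>2"
      have s: "?s > 0" by (smt (verit) zero_le_power2)
      \<comment> \<open>A small step against the sign of \<open>d\<close> makes the quadratic
        negative; the summand 1 in \<open>?s\<close> keeps the denominator positive even for
        \<open>x = 0\<close>.\<close>
      have "0 \<le> (- d / ?s)\<^sup>2 * (norm x)\<^sup>2 + 2 * (- d / ?s) * d" by (rule q)
      also have "\<dots> = - d\<^sup>2 * (?s + 1) / ?s\<^sup>2"
        using s by (simp add: divide_simps power2_eq_square) (simp add: algebra_simps)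
      also have "\<dots> < 0" using \<open>d \<noteq> 0\<close> s by (simp add: divide_neg_pos mult_pos_pos)
      finally show False by simp
    qed
    thus ?thesis by (simp add: d_def)
  qed
  thus thesis by (rule that)
qed

text \<open>\<open>Im (cinner x y) = - Re (cinner (\<i> *\<^sub>C x) y)\<close>, so the real inner
  product determines the complex one and identities of real parts lift to
  \<open>cinner\<close>.\<close>

lemma cinner_eq_iff: "cinner x y = cinner x' y' \<longleftrightarrow>
    inner x y = inner x' y' \<and> inner (\<i> *\<^sub>C x) y = inner (\<i> *\<^sub>C x') y'"
  for x y :: "'a::complex_inner" and x' y' :: "'b::complex_inner"
  by (simp add: Re_cinner[symmetric] cinner_scaleC_left complex_eq_iff)

lemma cinner_left_unique: "(\<And>x. cinner x u = cinner x v) \<Longrightarrow> u = v"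
  for u v :: "'a::complex_inner"
  by (metis Re_cinner vector_eq_ldot)

text \<open>Real Riesz representation applied to
  \<open>x \<mapsto> Re \<langle>A x, y\<rangle>\<close> for each \<open>y\<close>; complex
  linearity of \<open>A\<close> lifts the real adjoint identity to \<open>cinner\<close>.\<close>

lemma ex_adjoint:
  fixes A :: "'a::chilbert_space \<Rightarrow>\<^sub>L 'b::chilbert_space"
  assumes A: "clinear_op A"
  shows "\<exists>B. \<forall>x y. cinner (blinfun_apply A x) y = cinner x (blinfun_apply B y)"
proof -
  have "\<exists>z. \<forall>x. inner (blinfun_apply A x) y = inner x z" for y
    using riesz_representation[OF bounded_linear_compose[OF bounded_linear_inner_left
        blinfun.bounded_linear_right]] by metis
  then obtain B where B: "\<And>x y. inner (blinfun_apply A x) y = inner x (B y)" by metis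
  have add: "B (y + z) = B y + B z" for y z
    by (subst vector_eq_ldot[symmetric]) (simp add: B[symmetric] inner_add_right)
  have scale: "B (r *\<^sub>R y) = r *\<^sub>R B y" for r y
    by (subst vector_eq_ldot[symmetric]) (simp add: B[symmetric])
  have bound: "norm (B y) \<le> norm y * norm A" for y
  proof -
    \<comment> \<open>The adjoint identity is tested at \<open>x = B y\<close>; one factor
      \<open>norm (B y)\<close> cancels afterwards.\<close>
    have "(norm (B y))\<^sup>2 = inner (blinfun_apply A (B y)) y"
      by (simp add: B power2_norm_eq_inner)
    also have "\<dots> \<le> norm (blinfun_apply A (B y)) * norm y" by (rule norm_cauchy_schwarz)
    also have "\<dots> \<le> norm A * norm (B y) * norm y" by (intro mult_right_mono norm_blinfun) auto
    finally have "norm (B y) * norm (B y) \<le> (norm y * norm A) * norm (B y)"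
      by (simp add: power2_eq_square mult_ac)
    thus ?thesis by (cases "norm (B y) = 0") (auto simp: mult_le_cancel_right)
  qed
  have "bounded_linear B" by (rule bounded_linear_intro[OF add scale bound])
  hence "blinfun_apply (Blinfun B) = B" by (rule bounded_linear_Blinfun_apply)
  hence "cinner (blinfun_apply A x) y = cinner x (blinfun_apply (Blinfun B) y)" for x y
    using A by (simp add: cinner_eq_iff B[symmetric] clinear_op_def)
  thus ?thesis by blast
qed

text \<open>The inner product separates vectors, so at most one operator satisfies the adjoint
  identity, and exhibiting one evaluates the definite description \<open>adj\<close>.\<close>

lemma adj_eqI:
  assumes "\<And>x y. cinner (blinfun_apply A x) y = cinner x (blinfun_apply B y)"
  shows "adj A = B"
  unfolding adj_def
proof (rule the_equality)
  fix B' assume "\<forall>x y. cinner (blinfun_apply A x) y = cinner x (blinfun_apply B' y)"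
  hence "cinner x (blinfun_apply B' y) = cinner x (blinfun_apply B y)" for x y
    by (metis assms)
  thus "B' = B" by (intro blinfun_eqI) (rule cinner_left_unique)
qed (use assms in blast)

lemma cinner_adj: "clinear_op A \<Longrightarrow> cinner (blinfun_apply A x) y = cinner x (blinfun_apply (adj A) y)"
  by (metis ex_adjoint adj_eqI)

lemma cinner_adj': "clinear_op A \<Longrightarrow> cinner (blinfun_apply (adj A) x) y = cinner x (blinfun_apply A y)"
  by (metis cinner_adj cinner_commute)

lemma norm_adj_apply_le:
  assumes "clinear_op A" shows "norm (blinfun_apply (adj A) y) \<le> norm A * norm y"
proof -
  let ?z = "blinfun_apply (adj A) y"
  have "(norm ?z)\<^sup>2 = inner (blinfun_apply A ?z) y"
    using cinner_adj[OF assms, of ?z y] by (simp add: power2_norm_eq_inner Re_cinner[symmetric])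
  also have "\<dots> \<le> norm (blinfun_apply A ?z) * norm y" by (rule norm_cauchy_schwarz)
  also have "\<dots> \<le> norm A * norm ?z * norm y" by (intro mult_right_mono norm_blinfun) auto
  finally have "norm ?z * norm ?z \<le> (norm A * norm y) * norm ?z"
    by (simp add: power2_eq_square mult_ac)
  thus ?thesis by (cases "norm ?z = 0") (auto simp: mult_le_cancel_right)
qed

lemma norm_adj_le: "clinear_op A \<Longrightarrow> norm (adj A) \<le> norm A"
  by (intro norm_blinfun_bound norm_adj_apply_le) auto

section \<open>Sesquilinearity and continuity of the complex inner product\<close>

lemma cinner_simps:
  fixes x y z :: "'a::complex_inner"
  shows "cinner (x + y) z = cinner x z + cinner y z" "cinner z (x + y) = cinner z x + cinner z y"
    "cinner (x - y) z = cinner x z - cinner y z" "cinner z (x - y) = cinner z x - cinner z y"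
    "cinner (a *\<^sub>C x) y = a * cinner x y" "cinner x (a *\<^sub>C y) = cnj a * cinner x y"
    "cinner (r *\<^sub>R x) y = of_real r * cinner x y" "cinner x (r *\<^sub>R y) = of_real r * cinner x y"
    "cinner 0 x = 0" "cinner x 0 = 0"
proof -
  show r: "cinner z (x + y) = cinner z x + cinner z y" for x y z :: 'a
    by (metis cinner_add_left cinner_commute complex_cnj_add)
  show R: "cinner (r *\<^sub>R x) y = of_real r * cinner x y" for r and x y :: 'a
    by (metis cinner_scaleC_left scaleC_of_real)
  show R': "cinner x (r *\<^sub>R y) = of_real r * cinner x y" for r and x y :: 'a
    by (metis R cinner_commute complex_cnj_mult complex_cnj_complex_of_real)
  show "cinner (x - y) z = cinner x z - cinner y z"
    using cinner_add_left[of x "(-1) *\<^sub>R y" z] by (simp only: R) simp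
  show "cinner z (x - y) = cinner z x - cinner z y"
    using r[of z x "(-1) *\<^sub>R y"] by (simp only: R') simp
  show "cinner 0 x = 0" using R[of 0 x x] by simp
  show "cinner x 0 = 0" using R'[of x 0 x] by simp
qed (auto simp: cinner_add_left cinner_scaleC_left cinner_scaleC_right)

lemma cinner_sum_left: "cinner (\<Sum>i\<in>S. f i) y = (\<Sum>i\<in>S. cinner (f i) (y :: 'a::complex_inner))"
  by (induction S rule: infinite_finite_induct) (auto simp: cinner_simps)

lemma cinner_sum_right: "cinner y (\<Sum>i\<in>S. f i) = (\<Sum>i\<in>S. cinner (y :: 'a::complex_inner) (f i))"
  by (induction S rule: infinite_finite_induct) (auto simp: cinner_simps)

lemma bounded_linear_cinner_left: "bounded_linear (\<lambda>x. cinner x (y :: 'a::complex_inner))"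
proof (rule bounded_linear_intro[where K="2 * norm y"])
  show "norm (cinner x y) \<le> norm x * (2 * norm y)" for x
    using norm_cinner_le[of x y] by (simp add: mult_ac)
qed (auto simp: cinner_simps scaleR_conv_of_real)

text \<open>Lets matrix coefficients pass inside the norm-convergent operator series of the
  kernels.\<close>

lemma bounded_linear_cinner_blinfun:
  "bounded_linear (\<lambda>A. cinner (blinfun_apply A x) (y :: 'a::complex_inner))"
  by (rule bounded_linear_compose[OF bounded_linear_cinner_left blinfun.bounded_linear_left])

section \<open>Powers, their adjoints and the power bound\<close>

lemma clinear_op_pow: "clinear_op A \<Longrightarrow> clinear_op (op_pow A k)"
  by (induction k) (auto simp: clinear_op_def)

lemma op_pow_apply_Suc: "blinfun_apply (op_pow A (Suc k)) x = blinfun_apply (op_pow A k) (blinfun_apply A x)"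
  by (induction k) auto

lemma cinner_op_pow_adj:
  assumes "clinear_op A"
  shows "cinner (blinfun_apply (op_pow (adj A) k) x) y = cinner x (blinfun_apply (op_pow A k) y)"
proof (induction k arbitrary: y)
  case (Suc k)
  have "cinner (blinfun_apply (op_pow (adj A) (Suc k)) x) y =
      cinner (blinfun_apply (op_pow (adj A) k) x) (blinfun_apply A y)"
    by (simp add: cinner_adj'[OF assms])
  thus ?case by (simp only: Suc op_pow_apply_Suc)
qed simp

lemma op_pow_adj:
  assumes "clinear_op A"
  shows "op_pow (adj A) k = adj (op_pow A k)"
  by (rule adj_eqI[symmetric]) (metis cinner_op_pow_adj[OF assms] cinner_commute)

lemma clinear_adj:
  assumes "clinear_op A" shows "clinear_op (adj A)"
  unfolding clinear_op_def
  by (intro allI, rule cinner_left_unique) (simp add: cinner_adj[OF assms, symmetric] cinner_scaleC_right)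

lemma norm_op_pow_isometry:
  assumes "isometry_op V" shows "norm (blinfun_apply (op_pow V k) x) = norm x"
  using assms by (induction k) (auto simp: isometry_op_def)

text \<open>Compressions of the isometries \<open>V^k\<close> have norm at most 1, which bounds
  \<open>T^k\<close> by \<open>\<rho>\<close> for \<open>k \<ge> 1\<close>. The maximum with 1
  accounts for \<open>k = 0\<close>, where the power is the identity and the dilation formula says
  nothing.\<close>

lemma rho_contraction_power_bounded:
  assumes "rho_contraction TYPE('g::chilbert_space) \<rho> (T :: 'a::chilbert_space \<Rightarrow>\<^sub>L 'a)" "\<rho> > 0"
  shows "norm (op_pow T k) \<le> max 1 \<rho>"
proof (rule norm_blinfun_bound)
  fix x
  from assms obtain J :: "'a \<Rightarrow>\<^sub>L 'g" and V where J: "isometry_op J" and V: "isometry_op V"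
    and T: "\<And>k. k \<ge> 1 \<Longrightarrow> op_pow T k = \<rho> *\<^sub>R (adj J o\<^sub>L op_pow V k o\<^sub>L J)"
    unfolding rho_contraction_def by auto
  show "norm (blinfun_apply (op_pow T k) x) \<le> max 1 \<rho> * norm x"
  proof (cases "k \<ge> 1")
    case True
    have "norm J \<le> 1" using J by (intro norm_blinfun_bound) (auto simp: isometry_op_def)
    have "norm (blinfun_apply (adj J) y) \<le> norm y" for y
    proof -
      have "norm (blinfun_apply (adj J) y) \<le> norm J * norm y"
        using J by (intro norm_adj_apply_le) (auto simp: isometry_op_def)
      also have "\<dots> \<le> 1 * norm y" using \<open>norm J \<le> 1\<close> by (intro mult_right_mono) auto
      finally show ?thesis by simp
    qed
    hence "norm (blinfun_apply (adj J) (blinfun_apply (op_pow V k) (blinfun_apply J x))) \<le> norm x"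
      by (metis J V isometry_op_def norm_op_pow_isometry)
    hence "norm (blinfun_apply (op_pow T k) x) \<le> \<rho> * norm x"
      using assms by (simp add: T[OF True] blinfun.scaleR_left mult_left_mono)
    also have "\<dots> \<le> max 1 \<rho> * norm x" by (intro mult_right_mono) auto
    finally show ?thesis .
  next
    case False
    hence "k = 0" by simp
    moreover have "1 * norm x \<le> max 1 \<rho> * norm x" by (intro mult_right_mono) auto
    ultimately show ?thesis by simp
  qed
qed (use assms in auto)


section \<open>Fourier coefficients and Schur products\<close>

text \<open>The circle is parametrized by \<open>[0, 1]\<close> with total mass one. For
  \<open>n \<noteq> 0\<close> the antiderivative \<open>cis (a * t) / (\<i> * a)\<close> takes equal
  values at both ends.\<close>

lemma cis_power_int_has_integral:
  "((\<lambda>t. cis (2 * pi * t) powi n) has_integral (if n = 0 then 1 else 0)) {0..1}"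
proof (cases "n = 0")
  case True
  thus ?thesis using has_integral_const_real[of "1::complex" 0 1] by simp
next
  case False
  define a where "a = 2 * pi * real_of_int n"
  have a: "a \<noteq> 0" using False by (simp add: a_def)
  have "((\<lambda>t. cis (a * t)) has_integral
      (cis (a * 1) / (\<i> * of_real a) - cis (a * 0) / (\<i> * of_real a))) {0..1}"
  proof (rule fundamental_theorem_of_calculus)
    fix x :: real
    have "((\<lambda>z. exp (\<i> * of_real a * z) / (\<i> * of_real a)) has_field_derivative
        exp (\<i> * of_real a * of_real x)) (at (of_real x))"
      using a by (auto intro!: derivative_eq_intros)
    from has_vector_derivative_real_field[OF this]
    have "((\<lambda>t. exp (\<i> * of_real a * of_real t) / (\<i> * of_real a)) has_vector_derivative
        exp (\<i> * of_real a * of_real x)) (at x within {0..1})"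
      .
    thus "((\<lambda>t. cis (a * t) / (\<i> * of_real a)) has_vector_derivative cis (a * x)) (at x within {0..1})"
      by (simp add: cis_conv_exp mult.assoc)
  qed simp
  moreover have "cis (a * 1) = 1"
    using cis_multiple_2pi[of "real_of_int n"] by (simp add: a_def mult_ac)
  ultimately show ?thesis using False
    by (simp add: cis_power_int a_def mult_ac)
qed

text \<open>Absolute summability gives uniform convergence, hence termwise integration. The
  exponents \<open>s k\<close> are arbitrary, so series multiplied by a character are
  covered.\<close>

lemma cis_series_has_integral:
  fixes b :: "nat \<Rightarrow> complex" and s :: "nat \<Rightarrow> int"
  assumes b: "summable (\<lambda>k. norm (b k))"
  shows "((\<lambda>t. \<Sum>k. b k * cis (2 * pi * t) powi s k) has_integral
    (\<Sum>k. if s k = 0 then b k else 0)) {0..1}"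
proof -
  define f where "f k t = b k * cis (2 * pi * t) powi s k" for k t
  have nf: "norm (f k t) = norm (b k)" for k t
    by (simp add: f_def norm_mult norm_power_int)
  have int: "((\<lambda>t. \<Sum>k<n. f k t) has_integral (\<Sum>k<n. if s k = 0 then b k else 0)) {0..1}" for n
    unfolding f_def
  proof (intro has_integral_sum)
    show "((\<lambda>t. b k * cis (2 * pi * t) powi s k) has_integral (if s k = 0 then b k else 0)) {0..1}"
      for k
      using has_integral_mult_right[OF cis_power_int_has_integral[of "s k"], of "b k"]
      by (simp split: if_splits)
  qed simp
  have "uniform_limit {0..1} (\<lambda>n t. \<Sum>k<n. f k t) (\<lambda>t. \<Sum>k. f k t) sequentially"
    by (rule Weierstrass_m_test[OF _ b]) (simp add: nf)
  then obtain I J where I: "\<And>n. ((\<lambda>t. \<Sum>k<n. f k t) has_integral I n) {0..1}"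
    and J: "((\<lambda>t. \<Sum>k. f k t) has_integral J) {0..1}" and IJ: "I \<longlonglongrightarrow> J"
    by (rule uniform_limit_integral[where f="\<lambda>n t. \<Sum>k<n. f k t"])
       (auto simp: f_def intro!: continuous_intros)
  have "I n = (\<Sum>k<n. if s k = 0 then b k else 0)" for n
    by (rule has_integral_unique[OF I int])
  hence "I = (\<lambda>n. \<Sum>k<n. if s k = 0 then b k else 0)" by blast
  hence "(\<lambda>k. if s k = 0 then b k else 0) sums J" using IJ by (simp only: sums_def)
  thus ?thesis using J by (simp add: sums_iff f_def)
qed

section \<open>Positive semidefinite kernels on finite index sets\<close>

definition psd_on :: "'i set \<Rightarrow> ('i \<Rightarrow> 'i \<Rightarrow> complex) \<Rightarrow> bool" where
  "psd_on S P \<longleftrightarrow> (\<forall>v. (\<Sum>i\<in>S. \<Sum>j\<in>S. cnj (v i) * P i j * v j) \<in> \<real>\<^sub>\<ge>\<^sub>0)"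

lemma psd_onD: "psd_on S P \<Longrightarrow> (\<Sum>i\<in>S. \<Sum>j\<in>S. cnj (v i) * P i j * v j) \<in> \<real>\<^sub>\<ge>\<^sub>0"
  by (simp add: psd_on_def)

lemma psd_on_subset:
  assumes "psd_on S P" "R \<subseteq> S" "finite S"
  shows "psd_on R P"
  unfolding psd_on_def
proof
  fix v :: "'a \<Rightarrow> complex"
  define w where "w i = (if i \<in> R then v i else 0)" for i
  have "(\<Sum>i\<in>R. \<Sum>j\<in>R. cnj (v i) * P i j * v j) = (\<Sum>i\<in>R. \<Sum>j\<in>R. cnj (w i) * P i j * w j)"
    by (intro sum.cong) (auto simp: w_def)
  also have "\<dots> = (\<Sum>i\<in>R. \<Sum>j\<in>S. cnj (w i) * P i j * w j)"
    by (intro sum.cong sum.mono_neutral_left) (use assms in \<open>auto simp: w_def\<close>)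
  also have "\<dots> = (\<Sum>i\<in>S. \<Sum>j\<in>S. cnj (w i) * P i j * w j)"
    by (intro sum.mono_neutral_left) (use assms in \<open>auto simp: w_def\<close>)
  finally show "(\<Sum>i\<in>R. \<Sum>j\<in>R. cnj (v i) * P i j * v j) \<in> \<real>\<^sub>\<ge>\<^sub>0"
    using psd_onD[OF assms(1), of w] by simp
qed

lemma psd_on_diag:
  assumes "psd_on S P" "i \<in> S" "finite S"
  shows "P i i \<in> \<real>\<^sub>\<ge>\<^sub>0"
  using psd_onD[OF psd_on_subset[OF assms(1) _ assms(3), of "{i}"], of "\<lambda>_. 1"] assms(2) by simp

lemma psd_on_pair:
  assumes "psd_on S P" "i \<in> S" "j \<in> S" "i \<noteq> j" "finite S"
  shows "cnj a * P i i * a + cnj a * P i j * b + cnj b * P j i * a + cnj b * P j j * b \<in> \<real>\<^sub>\<ge>\<^sub>0"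
  using psd_onD[OF psd_on_subset[OF assms(1) _ assms(5), of "{i,j}"], of "\<lambda>k. if k = i then a else b"]
    assms by (simp add: add_ac)

text \<open>Realness of the form at \<open>e_i + e_j\<close> and at \<open>e_i + \<i> e_j\<close>
  yields the imaginary and the real part of the relation.\<close>

lemma psd_on_hermitian:
  assumes "psd_on S P" "i \<in> S" "j \<in> S" "finite S"
  shows "P j i = cnj (P i j)"
proof (cases "i = j")
  case True
  thus ?thesis using psd_on_diag[OF assms(1,2,4)] by (simp add: complex_nonneg_Reals_iff complex_eq_iff)
next
  case False
  have "Im (P i i) = 0" "Im (P j j) = 0"
    using psd_on_diag assms by (metis complex_nonneg_Reals_iff)+
  thus ?thesis
    using psd_on_pair[OF assms(1-3) False assms(4), of 1 1]
      psd_on_pair[OF assms(1-3) False assms(4), of 1 \<i>]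
    by (simp add: complex_nonneg_Reals_iff complex_eq_iff)
qed

text \<open>With \<open>P i i = 0\<close> and \<open>p = P i j\<close>, the form at
  \<open>- t p e_i + e_j\<close> is affine in \<open>t\<close> with slope \<open>- 2 |p|^2\<close>;
  it is nonnegative for all \<open>t\<close> only if \<open>p = 0\<close>.\<close>

lemma psd_on_zero_diag:
  assumes "psd_on S P" "i \<in> S" "j \<in> S" "finite S" "P i i = 0"
  shows "P i j = 0"
proof (cases "i = j")
  case False
  define p where "p = P i j"
  have ji: "P j i = cnj p" unfolding p_def by (rule psd_on_hermitian[OF assms(1-4)])
  have "0 \<le> Re (P j j) - 2 * t * (norm p)\<^sup>2" for t :: real
  proof -
    have "cnj (- of_real t * p) * P i i * (- of_real t * p) + cnj (- of_real t * p) * P i j * 1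
        + cnj 1 * P j i * (- of_real t * p) + cnj 1 * P j j * 1 \<in> \<real>\<^sub>\<ge>\<^sub>0"
      by (rule psd_on_pair[OF assms(1-3) False assms(4)])
    hence "0 \<le> Re (P j j) - 2 * t * Re (cnj p * p)"
      by (simp add: assms(5) ji p_def[symmetric] complex_nonneg_Reals_iff algebra_simps)
    moreover have "Re (cnj p * p) = (norm p)\<^sup>2"
      by (simp add: cmod_power2) (simp add: power2_eq_square)
    ultimately show ?thesis by simp
  qed
  \<comment> \<open>If \<open>p \<noteq> 0\<close>, this value of \<open>t\<close> makes the bound
    read \<open>0 \<le> - 1\<close>.\<close>
  from this[of "(Re (P j j) + 1) / (2 * (norm p)\<^sup>2)"] have "p = 0"
    by (cases "p = 0") auto
  thus ?thesis by (simp add: p_def)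
qed (use assms in simp)

text \<open>Induction on the index set by a Cholesky step: a nonzero pivot is eliminated by passing to the
  Schur complement \<open>R\<close>, which differs from \<open>P\<close> by a positive matrix of rank one.\<close>

lemma schur_product_nonneg:
  assumes "finite S" "psd_on S P" "psd_on S G"
  shows "(\<Sum>i\<in>S. \<Sum>j\<in>S. P i j * G i j) \<in> \<real>\<^sub>\<ge>\<^sub>0"
  using assms
proof (induction S arbitrary: P rule: finite_induct)
  case (insert s S)
  let ?I = "insert s S"
  have fin: "finite ?I" using insert by simp
  have split: "(\<Sum>i\<in>?I. \<Sum>j\<in>?I. F i j) =
      F s s + (\<Sum>j\<in>S. F s j) + (\<Sum>i\<in>S. F i s) + (\<Sum>i\<in>S. \<Sum>j\<in>S. F i j)"
    for F :: "'a \<Rightarrow> 'a \<Rightarrow> complex"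
    using insert.hyps by (simp add: sum.distrib add_ac)
  have herm: "P j i = cnj (P i j)" if "i \<in> ?I" "j \<in> ?I" for i j
    using psd_on_hermitian[OF insert.prems(1) that fin] .
  have GS: "psd_on S G" using psd_on_subset[OF insert.prems(2) _ fin] by blast
  show ?case
  proof (cases "P s s = 0")
    case True
    have z: "P s j = 0" "P j s = 0" if "j \<in> ?I" for j
      using psd_on_zero_diag[OF insert.prems(1) _ that fin True] herm[of s j] that by auto
    have "(\<Sum>i\<in>?I. \<Sum>j\<in>?I. P i j * G i j) = (\<Sum>i\<in>S. \<Sum>j\<in>S. P i j * G i j)"
      unfolding split by (simp add: z)
    thus ?thesis
      using insert.IH[OF psd_on_subset[OF insert.prems(1) _ fin] GS] by auto
  next
    case False
    define p where "p = Re (P s s)"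
    have p: "P s s = of_real p" "p > 0"
      using psd_on_diag[OF insert.prems(1) _ fin, of s] False
      by (auto simp: p_def complex_nonneg_Reals_iff complex_eq_iff less_le)
    define R where "R i j = P i j - P i s * P s j / of_real p" for i j
    have "psd_on S R"
      unfolding psd_on_def
    proof
      fix v :: "'a \<Rightarrow> complex"
      \<comment> \<open>Completing the square: this \<open>c\<close> minimizes the form of
        \<open>P\<close> over the coordinate \<open>s\<close> with the others fixed to
        \<open>v\<close>, and the minimum is the form of \<open>R\<close> at
        \<open>v\<close>.\<close>
      define c where "c = - (\<Sum>j\<in>S. P s j * v j) / of_real p"
      have c': "cnj c = - (\<Sum>i\<in>S. cnj (v i) * P i s) / of_real p"
      proof -
        have "(\<Sum>i\<in>S. cnj (v i) * P i s) = (\<Sum>i\<in>S. cnj (v i) * cnj (P s i))"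
          by (intro sum.cong refl) (use herm[of s] in auto)
        thus ?thesis by (simp add: c_def mult.commute)
      qed
      define w where "w i = (if i = s then c else v i)" for i
      have w: "w i = v i" if "i \<in> S" for i using that insert.hyps by (auto simp: w_def)
      have "(\<Sum>i\<in>?I. \<Sum>j\<in>?I. cnj (w i) * P i j * w j) =
          cnj c * P s s * c + (\<Sum>j\<in>S. cnj c * P s j * v j) + (\<Sum>i\<in>S. cnj (v i) * P i s * c)
          + (\<Sum>i\<in>S. \<Sum>j\<in>S. cnj (v i) * P i j * v j)"
        unfolding split by (simp add: w w_def[of s])
      also have "(\<Sum>j\<in>S. cnj c * P s j * v j) = cnj c * (- of_real p * c)"
      proof -
        have "(\<Sum>j\<in>S. P s j * v j) = - of_real p * c" using p by (simp add: c_def)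
        thus ?thesis by (simp only: mult.assoc sum_distrib_left[symmetric])
      qed
      also have "(\<Sum>i\<in>S. cnj (v i) * P i s * c) = (- of_real p * cnj c) * c"
      proof -
        have "(\<Sum>i\<in>S. cnj (v i) * P i s) = - of_real p * cnj c" using p by (simp add: c')
        thus ?thesis by (simp only: sum_distrib_right[symmetric])
      qed
      also have "cnj c * P s s * c + cnj c * (- of_real p * c) + (- of_real p * cnj c) * c =
          - (of_real p * cnj c * c)"
        using p by (simp add: mult_ac)
      also have "of_real p * cnj c * c = (\<Sum>i\<in>S. cnj (v i) * P i s) * (\<Sum>j\<in>S. P s j * v j) / of_real p"
        using p by (simp add: c' c_def[symmetric]) (simp add: c_def)
      also have "- \<dots> + (\<Sum>i\<in>S. \<Sum>j\<in>S. cnj (v i) * P i j * v j) =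
          (\<Sum>i\<in>S. \<Sum>j\<in>S. cnj (v i) * R i j * v j)"
        by (simp add: R_def sum_product sum_subtractf sum_divide_distrib algebra_simps)
          (rule sum.swap)
      finally show "(\<Sum>i\<in>S. \<Sum>j\<in>S. cnj (v i) * R i j * v j) \<in> \<real>\<^sub>\<ge>\<^sub>0"
        using psd_onD[OF insert.prems(1), of w] by simp
    qed
    hence 1: "(\<Sum>i\<in>S. \<Sum>j\<in>S. R i j * G i j) \<in> \<real>\<^sub>\<ge>\<^sub>0" using insert.IH GS by blast
    \<comment> \<open>Row and column \<open>s\<close> of \<open>R\<close> vanish, so the induction
      hypothesis on \<open>S\<close> covers the whole index set.\<close>
    have R0: "R s j = 0" "R i s = 0" for i j using p by (simp_all add: R_def)
    \<comment> \<open>The rank-one part contributes the form of \<open>G\<close> at the vector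
      \<open>P s\<close>, divided by the pivot.\<close>
    have "(\<Sum>i\<in>?I. \<Sum>j\<in>?I. cnj (P s i) * G i j * P s j) / of_real p \<in> \<real>\<^sub>\<ge>\<^sub>0"
      using psd_onD[OF insert.prems(2), of "P s"] p
      by (auto simp: complex_nonneg_Reals_iff)
    also have "(\<Sum>i\<in>?I. \<Sum>j\<in>?I. cnj (P s i) * G i j * P s j) / of_real p =
        (\<Sum>i\<in>?I. \<Sum>j\<in>?I. (P i s * P s j / of_real p) * G i j)"
      unfolding sum_divide_distrib using herm[of s] by (intro sum.cong refl) (auto simp: mult_ac)
    finally have 2: "(\<Sum>i\<in>?I. \<Sum>j\<in>?I. (P i s * P s j / of_real p) * G i j) \<in> \<real>\<^sub>\<ge>\<^sub>0" .
    have "(\<Sum>i\<in>?I. \<Sum>j\<in>?I. P i j * G i j) =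
        (\<Sum>i\<in>?I. \<Sum>j\<in>?I. R i j * G i j) + (\<Sum>i\<in>?I. \<Sum>j\<in>?I. (P i s * P s j / of_real p) * G i j)"
      unfolding sum.distrib[symmetric] by (intro sum.cong refl) (simp add: R_def algebra_simps)
    also have "(\<Sum>i\<in>?I. \<Sum>j\<in>?I. R i j * G i j) = (\<Sum>i\<in>S. \<Sum>j\<in>S. R i j * G i j)"
      unfolding split by (simp add: R0)
    finally show ?thesis using nonneg_Reals_add_I[OF 1 2] by simp
  qed
qed simp


section \<open>The kernel K\<close>

lemma norm_scaleC_blinfun_le: "norm (a *\<^sub>C A) \<le> cmod a * norm A"
  for A :: "'a::real_normed_vector \<Rightarrow>\<^sub>L 'b::complex_inner"
  by (rule norm_blinfun_bound)
     (auto simp: scaleC_blinfun.rep_eq norm_scaleC mult.assoc intro!: mult_left_mono norm_blinfun)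

lemma summable_power_op:
  fixes z :: complex and A :: "nat \<Rightarrow> 'a::real_normed_vector \<Rightarrow>\<^sub>L 'b::chilbert_space"
  assumes "norm z < 1" "\<And>k. norm (A k) \<le> C"
  shows "summable (\<lambda>k. (z ^ Suc k) *\<^sub>C A k)"
proof (rule summable_comparison_test')
  show "summable (\<lambda>k. norm z ^ Suc k * C)"
    using assms(1) by (intro summable_mult2) (simp add: summable_mult summable_geometric)
  show "norm ((z ^ Suc k) *\<^sub>C A k) \<le> norm z ^ Suc k * C" for k
  proof -
    have "norm ((z ^ Suc k) *\<^sub>C A k) \<le> norm (z ^ Suc k) * norm (A k)"
      by (rule norm_scaleC_blinfun_le)
    also have "\<dots> \<le> norm (z ^ Suc k) * C" by (intro mult_left_mono assms) auto
    finally show ?thesis by (simp add: norm_power norm_mult)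
  qed
qed

lemma summable_real_power_op:
  fixes r :: real and A :: "nat \<Rightarrow> 'b::banach"
  assumes "0 \<le> r" "r < 1" "\<And>k. norm (A k) \<le> C"
  shows "summable (\<lambda>k. r ^ Suc k *\<^sub>R A k)"
proof (rule summable_comparison_test')
  show "summable (\<lambda>k. r ^ Suc k * C)"
    using assms by (intro summable_mult2) (simp add: summable_mult summable_geometric)
  show "norm (r ^ Suc k *\<^sub>R A k) \<le> r ^ Suc k * C" for k
    using assms(1) by (simp add: mult_left_mono assms(3))
qed

lemma clinear_op_suminf:
  assumes "summable A" "\<And>k. clinear_op (A k)"
  shows "clinear_op (\<Sum>k. A k)"
  unfolding clinear_op_def
proof (intro allI)
  fix a x
  have app: "blinfun_apply (\<Sum>k. A k) x = (\<Sum>k. blinfun_apply (A k) x)" for x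
    by (rule bounded_linear.suminf[OF blinfun.bounded_linear_left assms(1)])
  have "a *\<^sub>C (\<Sum>k. blinfun_apply (A k) x) = (\<Sum>k. a *\<^sub>C blinfun_apply (A k) x)"
    by (rule bounded_linear.suminf[OF bounded_linear_scaleC
        bounded_linear.summable[OF blinfun.bounded_linear_left assms(1)]])
  thus "blinfun_apply (\<Sum>k. A k) (a *\<^sub>C x) = a *\<^sub>C blinfun_apply (\<Sum>k. A k) x"
    using assms(2) by (simp add: app clinear_op_def)
qed

lemma clinear_op_add: "clinear_op A \<Longrightarrow> clinear_op B \<Longrightarrow> clinear_op (A + B)"
  by (simp add: clinear_op_def blinfun.add_left scaleC_add_right)

lemma clinear_op_scaleR: "clinear_op A \<Longrightarrow> clinear_op (r *\<^sub>R A)"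
  by (simp add: clinear_op_def blinfun.scaleR_left scaleC_scaleR)

lemma clinear_op_scaleC: "clinear_op A \<Longrightarrow> clinear_op (a *\<^sub>C A)"
  by (simp add: clinear_op_def scaleC_blinfun.rep_eq scaleC_scaleC mult.commute)

lemma clinear_op_diff: "clinear_op A \<Longrightarrow> clinear_op B \<Longrightarrow> clinear_op (A - B)"
  using clinear_op_add[of A "(-1) *\<^sub>R B"] clinear_op_scaleR[of B "-1"] by simp

lemma clinear_op_id: "clinear_op id_blinfun"
  by (simp add: clinear_op_def)

locale power_bounded =
  fixes Y :: "'a::chilbert_space \<Rightarrow>\<^sub>L 'a" and C :: real
  assumes clinear: "clinear_op Y"
    and norm_pow_le: "\<And>k. norm (op_pow Y k) \<le> C"
begin

lemma norm_adj_pow_le: "norm (op_pow (adj Y) k) \<le> C"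
  using norm_adj_le[OF clinear_op_pow[OF clinear], of k] norm_pow_le[of k]
  by (simp add: op_pow_adj[OF clinear])

lemma K_kernel_summable:
  assumes "norm z < 1"
  shows "summable (\<lambda>k. (z ^ Suc k) *\<^sub>C op_pow (adj Y) (Suc k))"
    "summable (\<lambda>k. (cnj z ^ Suc k) *\<^sub>C op_pow Y (Suc k))"
  by (rule summable_power_op[OF assms norm_adj_pow_le])
     (rule summable_power_op[OF _ norm_pow_le], simp add: assms)

lemma K_kernel_scalar_summable:
  assumes "norm z < 1"
  shows "summable (\<lambda>k. z ^ Suc k * cinner x (blinfun_apply (op_pow Y (Suc k)) y))"
    "summable (\<lambda>k. cnj z ^ Suc k * cinner (blinfun_apply (op_pow Y (Suc k)) x) y)"
proof -
  note bl = bounded_linear.summable[OF bounded_linear_cinner_blinfun, of _ x y]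
  show "summable (\<lambda>k. z ^ Suc k * cinner x (blinfun_apply (op_pow Y (Suc k)) y))"
    using bl[OF K_kernel_summable(1)[OF assms]]
    by (simp only: scaleC_blinfun.rep_eq cinner_simps cinner_op_pow_adj[OF clinear])
  show "summable (\<lambda>k. cnj z ^ Suc k * cinner (blinfun_apply (op_pow Y (Suc k)) x) y)"
    using bl[OF K_kernel_summable(2)[OF assms]]
    by (simp only: scaleC_blinfun.rep_eq cinner_simps)
qed

lemma clinear_op_K_kernel: "norm z < 1 \<Longrightarrow> clinear_op (K_kernel \<rho> z Y)"
  unfolding K_kernel_def
  by (intro clinear_op_add clinear_op_suminf K_kernel_summable clinear_op_scaleC clinear_op_scaleR
      clinear_op_id clinear_op_pow clinear clinear_adj)

lemma cinner_K_kernel: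
  assumes "norm z < 1"
  shows "cinner (blinfun_apply (K_kernel \<rho> z Y) x) y =
    (\<Sum>k. z ^ Suc k * cinner x (blinfun_apply (op_pow Y (Suc k)) y)) + of_real \<rho> * cinner x y
    + (\<Sum>k. cnj z ^ Suc k * cinner (blinfun_apply (op_pow Y (Suc k)) x) y)"
proof -
  note bl = bounded_linear.suminf[OF bounded_linear_cinner_blinfun, of _ x y]
  have 1: "cinner (blinfun_apply (\<Sum>k. (z ^ Suc k) *\<^sub>C op_pow (adj Y) (Suc k)) x) y =
      (\<Sum>k. z ^ Suc k * cinner x (blinfun_apply (op_pow Y (Suc k)) y))"
    unfolding bl[OF K_kernel_summable(1)[OF assms]]
    by (simp only: scaleC_blinfun.rep_eq cinner_simps cinner_op_pow_adj[OF clinear])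
  have 2: "cinner (blinfun_apply (\<Sum>k. (cnj z ^ Suc k) *\<^sub>C op_pow Y (Suc k)) x) y =
      (\<Sum>k. cnj z ^ Suc k * cinner (blinfun_apply (op_pow Y (Suc k)) x) y)"
    unfolding bl[OF K_kernel_summable(2)[OF assms]]
    by (simp only: scaleC_blinfun.rep_eq cinner_simps)
  show ?thesis
    unfolding K_kernel_def blinfun.add_left cinner_simps 1 2 blinfun.scaleR_left
    by simp
qed

lemma norm_cinner_pow_le:
  "cmod (cinner (blinfun_apply (op_pow Y k) x) y) \<le> 2 * C * norm x * norm y"
  "cmod (cinner x (blinfun_apply (op_pow Y k) y)) \<le> 2 * C * norm x * norm y"
proof -
  have n: "norm (blinfun_apply (op_pow Y k) x) \<le> C * norm x" for x
    using norm_blinfun[of "op_pow Y k" x] mult_right_mono[OF norm_pow_le[of k], of "norm x"] by simp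
  show "cmod (cinner (blinfun_apply (op_pow Y k) x) y) \<le> 2 * C * norm x * norm y"
    using norm_cinner_le[of "blinfun_apply (op_pow Y k) x" y] mult_right_mono[OF n[of x], of "norm y"]
    by simp
  show "cmod (cinner x (blinfun_apply (op_pow Y k) y)) \<le> 2 * C * norm x * norm y"
    using norm_cinner_le[of x "blinfun_apply (op_pow Y k) y"] mult_left_mono[OF n[of y], of "norm x"]
    by (simp add: mult_ac)
qed

end

section \<open>Fourier coefficients of K on circles\<close>

text \<open>The \<open>n\<close>-th Fourier coefficient of
  \<open>\<zeta> \<mapsto> \<langle>K(r \<zeta>, Y) x, y\<rangle>\<close>: positive \<open>n\<close>
  carry adjoint powers, moved to the second argument, and negative \<open>n\<close> carry powers of
  \<open>Y\<close>.\<close>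

definition toeplitz_coeff ::
  "real \<Rightarrow> real \<Rightarrow> ('a::chilbert_space \<Rightarrow>\<^sub>L 'a) \<Rightarrow> int \<Rightarrow> 'a \<Rightarrow> 'a \<Rightarrow> complex" where
  "toeplitz_coeff \<rho> r Y n x y =
    (if n = 0 then of_real \<rho> * cinner x y
     else if n > 0 then of_real (r ^ nat n) * cinner x (blinfun_apply (op_pow Y (nat n)) y)
     else of_real (r ^ nat (- n)) * cinner (blinfun_apply (op_pow Y (nat (- n))) x) y)"

lemma suminf_if_int_eq:
  fixes b :: "nat \<Rightarrow> complex"
  shows "(\<Sum>k. if int (Suc k) = n then b (Suc k) else 0) = (if n > 0 then b (nat n) else 0)"
proof (cases "n > 0")
  case True
  have "(\<Sum>k. if int (Suc k) = n then b (Suc k) else 0) =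
      (\<Sum>k\<in>{nat n - 1}. if int (Suc k) = n then b (Suc k) else 0)"
    by (rule suminf_finite) auto
  thus ?thesis using True by auto
next
  case False
  have "(\<Sum>k. if int (Suc k) = n then b (Suc k) else 0) =
      (\<Sum>k\<in>{}. if int (Suc k) = n then b (Suc k) else 0)"
    by (rule suminf_finite) (use False in auto)
  thus ?thesis using False by simp
qed

text \<open>Multiplication by \<open>\<zeta>^l\<close> moves the coefficient of index
  \<open>- l\<close> to index 0, where the mean over the circle selects it; the series are
  integrated termwise.\<close>

lemma (in power_bounded) K_kernel_fourier_coeff:
  assumes r: "0 \<le> r" "r < 1"
  shows "((\<lambda>t. cis (2 * pi * t) powi l *
      cinner (blinfun_apply (K_kernel \<rho> (of_real r * cis (2 * pi * t)) Y) x) y)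
    has_integral toeplitz_coeff \<rho> r Y (- l) x y) {0..1}"
proof -
  define b where "b k = of_real (r ^ k) * cinner x (blinfun_apply (op_pow Y k) y)" for k
  define b' where "b' k = of_real (r ^ k) * cinner (blinfun_apply (op_pow Y k) x) y" for k
  let ?z = "\<lambda>t. of_real r * cis (2 * pi * t)"
  have sr: "summable (\<lambda>k. r ^ Suc k *\<^sub>R norm (cinner x (blinfun_apply (op_pow Y (Suc k)) y)))"
    "summable (\<lambda>k. r ^ Suc k *\<^sub>R norm (cinner (blinfun_apply (op_pow Y (Suc k)) x) y))"
    by (rule summable_real_power_op[OF r, where C="2 * C * norm x * norm y"],
        simp add: norm_cinner_pow_le del: op_pow.simps)+
  hence sb: "summable (\<lambda>k. norm (b (Suc k)))" "summable (\<lambda>k. norm (b' (Suc k)))"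
    using r by (simp_all add: b_def b'_def norm_mult norm_power del: op_pow.simps)
  have 1: "((\<lambda>t. \<Sum>k. b (Suc k) * cis (2 * pi * t) powi (l + int (Suc k))) has_integral
      (\<Sum>k. if l + int (Suc k) = 0 then b (Suc k) else 0)) {0..1}"
    by (rule cis_series_has_integral[OF sb(1)])
  have 2: "((\<lambda>t. \<Sum>k. b' (Suc k) * cis (2 * pi * t) powi (l - int (Suc k))) has_integral
      (\<Sum>k. if l - int (Suc k) = 0 then b' (Suc k) else 0)) {0..1}"
    by (rule cis_series_has_integral[OF sb(2)])
  have 3: "((\<lambda>t. of_real \<rho> * cinner x y * cis (2 * pi * t) powi l) has_integral
      (of_real \<rho> * cinner x y * (if l = 0 then 1 else 0))) {0..1}"
    by (rule has_integral_mult_right[OF cis_power_int_has_integral])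
  have "(\<Sum>k. if l + int (Suc k) = 0 then b (Suc k) else 0) = (if - l > 0 then b (nat (- l)) else 0)"
    unfolding suminf_if_int_eq[symmetric] by (intro suminf_cong) auto
  moreover have "(\<Sum>k. if l - int (Suc k) = 0 then b' (Suc k) else 0) = (if l > 0 then b' (nat l) else 0)"
    unfolding suminf_if_int_eq[symmetric] by (intro suminf_cong) auto
  ultimately have val: "(\<Sum>k. if l + int (Suc k) = 0 then b (Suc k) else 0) +
      of_real \<rho> * cinner x y * (if l = 0 then 1 else 0) +
      (\<Sum>k. if l - int (Suc k) = 0 then b' (Suc k) else 0) = toeplitz_coeff \<rho> r Y (- l) x y"
    by (auto simp: toeplitz_coeff_def b_def b'_def)
  have fn: "(\<Sum>k. b (Suc k) * cis (2 * pi * t) powi (l + int (Suc k))) +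
      of_real \<rho> * cinner x y * cis (2 * pi * t) powi l +
      (\<Sum>k. b' (Suc k) * cis (2 * pi * t) powi (l - int (Suc k))) =
      cis (2 * pi * t) powi l * cinner (blinfun_apply (K_kernel \<rho> (?z t) Y) x) y" for t
  proof -
    define c where "c = cis (2 * pi * t)"
    have c: "norm c = 1" "c \<noteq> 0" "cnj c = inverse c"
      by (simp_all add: c_def cis_cnj)
    let ?z = "of_real r * c"
    have z: "norm ?z < 1" using r c by (simp add: norm_mult)
    note sz = K_kernel_scalar_summable(1)[OF z] and sz' = K_kernel_scalar_summable(2)[OF z]
    have "b (Suc k) * c powi (l + int (Suc k)) =
        c powi l * (?z ^ Suc k * cinner x (blinfun_apply (op_pow Y (Suc k)) y))" for k
      by (simp only: b_def power_int_add[OF disjI1[OF c(2)]] power_int_of_nat power_mult_distrib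
          of_real_power mult_ac)
    hence 1: "(\<Sum>k. b (Suc k) * c powi (l + int (Suc k))) =
        c powi l * (\<Sum>k. ?z ^ Suc k * cinner x (blinfun_apply (op_pow Y (Suc k)) y))"
      by (simp only: suminf_mult[OF sz])
    \<comment> \<open>On the circle \<open>cnj c = inverse c\<close>, so conjugate powers become
      negative integer powers.\<close>
    have "cnj c ^ Suc k = c powi (- int (Suc k))" for k
      unfolding c(3) power_int_minus power_int_of_nat power_inverse ..
    hence "b' (Suc k) * c powi (l - int (Suc k)) =
        c powi l * (cnj (?z) ^ Suc k * cinner (blinfun_apply (op_pow Y (Suc k)) x) y)" for k
      by (simp only: b'_def power_int_add[OF disjI1[OF c(2)]] diff_conv_add_uminus power_mult_distrib
          complex_cnj_mult complex_cnj_complex_of_real of_real_power mult_ac)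
    hence 2: "(\<Sum>k. b' (Suc k) * c powi (l - int (Suc k))) =
        c powi l * (\<Sum>k. cnj (?z) ^ Suc k * cinner (blinfun_apply (op_pow Y (Suc k)) x) y)"
      by (simp only: suminf_mult[OF sz'])
    show ?thesis
      unfolding c_def[symmetric] cinner_K_kernel[OF z] 1 2 distrib_left by (simp only: mult_ac)
  qed
  show ?thesis
    using has_integral_add[OF has_integral_add[OF 1 3] 2] unfolding fn val .
qed

lemma has_integral_nonneg_Reals:
  fixes f :: "real \<Rightarrow> complex"
  assumes I: "(f has_integral I) S" and f: "\<And>t. t \<in> S \<Longrightarrow> f t \<in> \<real>\<^sub>\<ge>\<^sub>0"
  shows "I \<in> \<real>\<^sub>\<ge>\<^sub>0"
proof -
  have "((\<lambda>t. Re (f t)) has_integral Re I) S" "((\<lambda>t. Im (f t)) has_integral Im I) S"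
    using has_integral_linear[OF I bounded_linear_Re] has_integral_linear[OF I bounded_linear_Im]
    by (simp_all add: o_def)
  moreover have "((\<lambda>t. Im (f t)) has_integral 0) S"
    by (rule has_integral_is_0) (use f in \<open>auto simp: complex_nonneg_Reals_iff\<close>)
  ultimately show ?thesis
    using f has_integral_nonneg[of "\<lambda>t. Re (f t)" "Re I" S] has_integral_unique
    by (auto simp: complex_nonneg_Reals_iff)
qed


section \<open>Tensor products with powers of the shift\<close>

text \<open>Pure tensors are total by \<open>hardy_tensor_total\<close>, so bounded operators
  agreeing on them coincide; a candidate checked there is the one that \<open>tensor_op\<close>
  describes.\<close>

lemma tensor_op_eqI:
  assumes "\<And>x h. blinfun_apply B (hardy_tensor x h) = hardy_tensor (blinfun_apply A x) (blinfun_apply S h)"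
  shows "tensor_op A S = B"
  unfolding tensor_op_def
proof (rule the_equality)
  fix B' assume B': "\<forall>x h. blinfun_apply B' (hardy_tensor x h) = hardy_tensor (blinfun_apply A x) (blinfun_apply S h)"
  let ?X = "{hardy_tensor x h |(x::'a) h. True}"
  have "closed {f. blinfun_apply B' f = blinfun_apply B f}"
    by (intro closed_Collect_eq blinfun.continuous_on continuous_intros)
  moreover have "span ?X \<subseteq> {f. blinfun_apply B' f = blinfun_apply B f}"
  proof
    fix f assume "f \<in> span ?X"
    hence "blinfun_apply B' f = blinfun_apply B f"
      by (induction rule: span_induct_alt)
         (use B' assms in \<open>auto simp: blinfun.add_right blinfun.scaleR_right blinfun.zero_right\<close>)
    thus "f \<in> {f. blinfun_apply B' f = blinfun_apply B f}" by simp
  qed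
  ultimately have "closure (span ?X) \<subseteq> {f. blinfun_apply B' f = blinfun_apply B f}"
    by (intro closure_minimal)
  thus "B' = B" unfolding hardy_tensor_total by (intro blinfun_eqI) auto
qed (use assms in blast)

section \<open>Coordinatewise operators and shifts on vector-valued Hardy spaces\<close>

text \<open>For complex-linear \<open>A\<close> this is \<open>A\<close> tensor the
  identity.\<close>

lift_definition hardy_map :: "('a::complex_inner \<Rightarrow>\<^sub>L 'a) \<Rightarrow> 'a hardy \<Rightarrow> 'a hardy"
  is "\<lambda>A f n. blinfun_apply A (f n)"
proof -
  fix A :: "'a \<Rightarrow>\<^sub>L 'a" and f :: "nat \<Rightarrow> 'a"
  assume f: "summable (\<lambda>n. (norm (f n))\<^sup>2)"
  show "summable (\<lambda>n. (norm (blinfun_apply A (f n)))\<^sup>2)"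
  proof (rule summable_comparison_test'[OF summable_mult[OF f, of "(norm A)\<^sup>2"]])
    show "norm ((norm (blinfun_apply A (f n)))\<^sup>2) \<le> (norm A)\<^sup>2 * (norm (f n))\<^sup>2" for n
      using power_mono[OF norm_blinfun[of A "f n"], of 2] by (simp add: power_mult_distrib)
  qed
qed

text \<open>Identity tensor the adjoint shift; on \<open>complex hardy\<close> it is the adjoint
  shift itself.\<close>

lift_definition hardy_backshift :: "'a::complex_inner hardy \<Rightarrow> 'a hardy" is "\<lambda>f n. f (Suc n)"
  by (subst summable_Suc_iff)

lift_definition hardy_fwdshift :: "'a::complex_inner hardy \<Rightarrow> 'a hardy"
  is "\<lambda>f n. case n of 0 \<Rightarrow> 0 | Suc k \<Rightarrow> f k"
  by (subst summable_Suc_iff[symmetric]) simp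

lemma norm_hardy_le:
  fixes f :: "'a::complex_inner hardy" and g :: "'b::complex_inner hardy"
  assumes "\<And>n. norm (fourier f n) \<le> K * norm (fourier g n)" "K \<ge> 0"
  shows "norm f \<le> K * norm g"
proof -
  have "(norm f)\<^sup>2 \<le> (\<Sum>n. K\<^sup>2 * (norm (fourier g n))\<^sup>2)"
    unfolding norm_hardy_sq
  proof (rule suminf_le[OF _ summable_norm_coeff summable_mult[OF summable_norm_coeff]])
    show "(norm (fourier f n))\<^sup>2 \<le> K\<^sup>2 * (norm (fourier g n))\<^sup>2" for n
      using power_mono[OF assms(1)[of n], of 2] by (simp add: power_mult_distrib)
  qed
  also have "\<dots> = (K * norm g)\<^sup>2"
    unfolding power_mult_distrib norm_hardy_sq by (rule suminf_mult[OF summable_norm_coeff])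
  finally show ?thesis
    by (rule power2_le_imp_le) (use assms in auto)
qed

lemma bounded_linear_hardy_map: "bounded_linear (hardy_map A)"
proof (rule bounded_linear_intro[where K="norm A"])
  show "hardy_map A (f + g) = hardy_map A f + hardy_map A g" for f g
    by transfer (simp add: blinfun.add_right)
  show "hardy_map A (r *\<^sub>R f) = r *\<^sub>R hardy_map A f" for r f
    by transfer (simp add: blinfun.scaleR_right)
  show "norm (hardy_map A f) \<le> norm f * norm A" for f
    using norm_hardy_le[of "hardy_map A f" "norm A" f]
    by (simp add: hardy_map.rep_eq norm_blinfun mult.commute)
qed

lemma norm_hardy_backshift_le: "norm (hardy_backshift f) \<le> norm f"
proof -
  have "(norm (hardy_backshift f))\<^sup>2 \<le> (norm f)\<^sup>2"
    using suminf_split_head[OF summable_norm_coeff[of f]]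
    by (simp add: norm_hardy_sq hardy_backshift.rep_eq)
  thus ?thesis by (rule power2_le_imp_le) simp
qed

lemma bounded_linear_hardy_backshift: "bounded_linear hardy_backshift"
  by (rule bounded_linear_intro[where K=1]; (simp add: norm_hardy_backshift_le)?; transfer; simp)

lemma norm_hardy_fwdshift: "norm (hardy_fwdshift f) = norm f"
proof -
  have "(norm (hardy_fwdshift f))\<^sup>2 = (norm f)\<^sup>2"
    using suminf_split_head[OF summable_norm_coeff[of "hardy_fwdshift f"]]
    by (simp add: norm_hardy_sq hardy_fwdshift.rep_eq)
  thus ?thesis by simp
qed

lemma bounded_linear_hardy_fwdshift: "bounded_linear hardy_fwdshift"
  by (rule bounded_linear_intro[where K=1]; (simp add: norm_hardy_fwdshift)?; transfer; auto split: nat.splits)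

lemma adj_unilateral_shift: "adj unilateral_shift = Blinfun hardy_backshift"
proof (rule adj_eqI)
  fix f g :: "complex hardy"
  have "cinner (hardy_shift f) g = cinner f (hardy_backshift g)"
    using suminf_split_head[OF summable_cinner[OF summable_norm_coeff[of "hardy_shift f"]
        summable_norm_coeff[of g]]]
    by (simp add: cinner_hardy.rep_eq hardy_shift.rep_eq hardy_backshift.rep_eq cinner_simps)
  thus "cinner (blinfun_apply unilateral_shift f) g =
      cinner f (blinfun_apply (Blinfun hardy_backshift) g)"
    by (simp add: unilateral_shift.rep_eq bounded_linear_Blinfun_apply[OF bounded_linear_hardy_backshift])
qed

lemma clinear_op_unilateral_shift: "clinear_op unilateral_shift"
  unfolding clinear_op_def unilateral_shift.rep_eq
  by (intro allI, transfer) (auto simp: scaleC_complex_def split: nat.splits)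

lemma norm_op_pow_le_one: "norm (op_pow A k) \<le> 1" if "norm A \<le> 1"
proof (induction k)
  case 0
  show ?case using norm_blinfun_id_le by simp
next
  case (Suc k)
  have "norm (op_pow A (Suc k)) \<le> norm A * norm (op_pow A k)" by (simp add: norm_blinfun_compose)
  also have "\<dots> \<le> 1 * 1" by (intro mult_mono that Suc) auto
  finally show ?case by simp
qed

text \<open>With \<open>S'\<close> in the role of identity tensor \<open>S\<close>, the
  factorization \<open>A \<otimes> S^k = (A \<otimes> I) (I \<otimes> S)^k\<close> provides both an
  operator meeting the description of \<open>tensor_op\<close> and the norm bound.\<close>

lemma tensor_op_lift:
  fixes A :: "'a::chilbert_space \<Rightarrow>\<^sub>L 'a" and S' :: "'a hardy \<Rightarrow>\<^sub>L 'a hardy"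
  assumes A: "clinear_op A"
    and S': "\<And>x h. blinfun_apply S' (hardy_tensor x h) = hardy_tensor x (blinfun_apply S h)"
    and n: "norm S' \<le> 1"
  shows "blinfun_apply (tensor_op A (op_pow S k)) (hardy_tensor x h) =
      hardy_tensor (blinfun_apply A x) (blinfun_apply (op_pow S k) h)" (is ?T)
    and "norm (tensor_op A (op_pow S k)) \<le> norm A" (is ?N)
proof -
  define B where "B = Blinfun (hardy_map A) o\<^sub>L op_pow S' k"
  have M: "blinfun_apply (Blinfun (hardy_map A)) = hardy_map A"
    by (rule bounded_linear_Blinfun_apply[OF bounded_linear_hardy_map])
  have t: "hardy_map A (hardy_tensor x h) = hardy_tensor (blinfun_apply A x) h" for x h
    using A by transfer (simp add: clinear_op_def)
  have p: "blinfun_apply (op_pow S' k) (hardy_tensor x h) = hardy_tensor x (blinfun_apply (op_pow S k) h)"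
    for x h
    by (induction k) (auto simp: S')
  have B: "blinfun_apply B (hardy_tensor x h) =
      hardy_tensor (blinfun_apply A x) (blinfun_apply (op_pow S k) h)" for x h
    by (simp add: B_def M p t)
  hence eq: "tensor_op A (op_pow S k) = B" by (rule tensor_op_eqI)
  show ?T by (simp add: eq B)
  have "norm (Blinfun (hardy_map A)) \<le> norm A"
    by (rule norm_blinfun_bound)
       (auto simp: M hardy_map.rep_eq norm_blinfun intro!: norm_hardy_le)
  hence "norm B \<le> norm A * 1"
    unfolding B_def
    by (intro order_trans[OF norm_blinfun_compose] mult_mono norm_op_pow_le_one n) auto
  thus ?N by (simp add: eq)
qed

lemma tensor_op_shift:
  assumes "clinear_op (A :: 'a::chilbert_space \<Rightarrow>\<^sub>L 'a)"
  shows "blinfun_apply (tensor_op A (op_pow unilateral_shift k)) (hardy_tensor x h) =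
      hardy_tensor (blinfun_apply A x) (blinfun_apply (op_pow unilateral_shift k) h)"
    and "norm (tensor_op A (op_pow unilateral_shift k)) \<le> norm A"
proof -
  let ?S = "Blinfun hardy_fwdshift :: 'a hardy \<Rightarrow>\<^sub>L 'a hardy"
  have S: "blinfun_apply ?S = hardy_fwdshift"
    by (rule bounded_linear_Blinfun_apply[OF bounded_linear_hardy_fwdshift])
  have 1: "blinfun_apply ?S (hardy_tensor x h) = hardy_tensor x (blinfun_apply unilateral_shift h)" for x h
    unfolding S unilateral_shift.rep_eq
    by transfer (auto split: nat.splits simp: scaleC_of_real[of 0, simplified])
  have 2: "norm ?S \<le> 1"
    by (rule norm_blinfun_bound) (auto simp: S norm_hardy_fwdshift)
  show "blinfun_apply (tensor_op A (op_pow unilateral_shift k)) (hardy_tensor x h) =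
      hardy_tensor (blinfun_apply A x) (blinfun_apply (op_pow unilateral_shift k) h)"
    and "norm (tensor_op A (op_pow unilateral_shift k)) \<le> norm A"
    by (rule tensor_op_lift[OF assms 1 2])+
qed

lemma tensor_op_backshift:
  assumes "clinear_op (A :: 'a::chilbert_space \<Rightarrow>\<^sub>L 'a)"
  shows "blinfun_apply (tensor_op A (op_pow (adj unilateral_shift) k)) (hardy_tensor x h) =
      hardy_tensor (blinfun_apply A x) (blinfun_apply (op_pow (adj unilateral_shift) k) h)"
    and "norm (tensor_op A (op_pow (adj unilateral_shift) k)) \<le> norm A"
proof -
  let ?S = "Blinfun hardy_backshift :: 'a hardy \<Rightarrow>\<^sub>L 'a hardy"
  have S: "blinfun_apply ?S = hardy_backshift"
    by (rule bounded_linear_Blinfun_apply[OF bounded_linear_hardy_backshift])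
  have 1: "blinfun_apply ?S (hardy_tensor x h) = hardy_tensor x (blinfun_apply (adj unilateral_shift) h)" for x h
    unfolding S adj_unilateral_shift bounded_linear_Blinfun_apply[OF bounded_linear_hardy_backshift]
    by transfer simp
  have 2: "norm ?S \<le> 1"
    by (rule norm_blinfun_bound) (auto simp: S norm_hardy_backshift_le)
  show "blinfun_apply (tensor_op A (op_pow (adj unilateral_shift) k)) (hardy_tensor x h) =
      hardy_tensor (blinfun_apply A x) (blinfun_apply (op_pow (adj unilateral_shift) k) h)"
    and "norm (tensor_op A (op_pow (adj unilateral_shift) k)) \<le> norm A"
    by (rule tensor_op_lift[OF assms 1 2])+
qed

section \<open>Matrix coefficients of Q\<close>

context power_bounded
begin

text \<open>The tensor operators are bounded by \<open>C\<close>, so both series converge in norm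
  and can be evaluated termwise on pure tensors, where every term factors.\<close>

lemma cinner_Q_kernel_tensor:
  assumes r: "0 \<le> r" "r < 1"
  shows "cinner (blinfun_apply (Q_kernel \<rho> r Y) (hardy_tensor x h)) (hardy_tensor y g) =
    (\<Sum>k. of_real (r ^ Suc k) * cinner x (blinfun_apply (op_pow Y (Suc k)) y) *
      cinner (blinfun_apply (op_pow unilateral_shift (Suc k)) h) g)
    + of_real \<rho> * cinner x y * cinner h g
    + (\<Sum>k. of_real (r ^ Suc k) * cinner (blinfun_apply (op_pow Y (Suc k)) x) y *
      cinner h (blinfun_apply (op_pow unilateral_shift (Suc k)) g))"
proof -
  note bl = bounded_linear.suminf[OF bounded_linear_cinner_blinfun, of _ "hardy_tensor x h" "hardy_tensor y g"]
  have cl: "clinear_op (op_pow Y k)" "clinear_op (op_pow (adj Y) k)" for k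
    by (intro clinear_op_pow clinear clinear_adj)+
  have s1: "summable (\<lambda>k. r ^ Suc k *\<^sub>R tensor_op (op_pow (adj Y) (Suc k)) (op_pow unilateral_shift (Suc k)))"
    by (rule summable_real_power_op[OF r, where C=C])
       (rule order_trans[OF tensor_op_shift(2)[OF cl(2)] norm_adj_pow_le])
  have s2: "summable (\<lambda>k. r ^ Suc k *\<^sub>R tensor_op (op_pow Y (Suc k)) (op_pow (adj unilateral_shift) (Suc k)))"
    by (rule summable_real_power_op[OF r, where C=C])
       (rule order_trans[OF tensor_op_backshift(2)[OF cl(1)] norm_pow_le])
  \<comment> \<open>The identity is the zeroth power of the shift.\<close>
  have id: "blinfun_apply (tensor_op id_blinfun id_blinfun) (hardy_tensor x h) = hardy_tensor x h"
    using tensor_op_shift(1)[OF clinear_op_id, of 0 x h] by simp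
  show ?thesis
    unfolding Q_kernel_def blinfun.add_left cinner_simps bl[OF s1] bl[OF s2] blinfun.scaleR_left
      tensor_op_shift(1)[OF cl(2)] tensor_op_backshift(1)[OF cl(1)] id cinner_hardy_tensor
      cinner_op_pow_adj[OF clinear] cinner_op_pow_adj[OF clinear_op_unilateral_shift]
    by (simp only: mult.assoc)
qed

end

text \<open>The monomials of the Hardy space.\<close>

lift_definition hardy_unit :: "nat \<Rightarrow> complex hardy" is "\<lambda>k n. if n = k then 1 else 0"
  subgoal for k by (rule summable_finite[of "{k}"]) auto
  done

lemma shift_hardy_unit: "blinfun_apply (op_pow unilateral_shift k) (hardy_unit j) = hardy_unit (j + k)"
proof (induction k)
  case (Suc k)
  have "hardy_shift (hardy_unit n) = hardy_unit (Suc n)" for n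
    by transfer (auto split: nat.splits)
  with Suc show ?case by (simp add: unilateral_shift.rep_eq)
qed simp

lemma cinner_hardy_unit: "cinner (hardy_unit i) (hardy_unit j) = (if i = j then 1 else 0)"
proof (transfer fixing: i j)
  have "(\<Sum>n. cinner (if n = i then 1 else 0) (if n = j then 1 else 0 :: complex)) =
      (\<Sum>n\<in>{i}. cinner (if n = i then 1 else 0) (if n = j then 1 else 0 :: complex))"
    by (rule suminf_finite) (auto simp: cinner_complex_def)
  thus "(\<Sum>n. cinner (if n = i then 1 else 0) (if n = j then 1 else 0 :: complex)) = (if i = j then 1 else 0)"
    by (simp add: cinner_complex_def)
qed

text \<open>The shift moves monomials up one degree at a time, so only the power
  \<open>|i - j|\<close> survives: Q is the Toeplitz matrix of the Fourier coefficients of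
  K.\<close>

lemma (in power_bounded) cinner_Q_kernel_unit:
  assumes r: "0 \<le> r" "r < 1"
  shows "cinner (blinfun_apply (Q_kernel \<rho> r Y) (hardy_tensor x (hardy_unit j)))
      (hardy_tensor y (hardy_unit i)) = toeplitz_coeff \<rho> r Y (int i - int j) x y"
proof -
  define b where "b k = of_real (r ^ k) * cinner x (blinfun_apply (op_pow Y k) y)" for k
  define b' where "b' k = of_real (r ^ k) * cinner (blinfun_apply (op_pow Y k) x) y" for k
  have 1: "(\<Sum>k. b (Suc k) * (if j + Suc k = i then 1 else 0)) =
      (if int i - int j > 0 then b (nat (int i - int j)) else 0)"
    unfolding suminf_if_int_eq[symmetric] by (intro suminf_cong) auto
  have 2: "(\<Sum>k. b' (Suc k) * (if j = i + Suc k then 1 else 0)) =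
      (if int j - int i > 0 then b' (nat (int j - int i)) else 0)"
    unfolding suminf_if_int_eq[symmetric] by (intro suminf_cong) auto
  show ?thesis
    unfolding cinner_Q_kernel_tensor[OF r] shift_hardy_unit cinner_hardy_unit
      b_def[symmetric] b'_def[symmetric] 1 2 toeplitz_coeff_def
    by auto
qed


section \<open>Equivalence of the kernel inequalities\<close>

text \<open>Here \<open>h\<close> is an eigenvector of the backward shift.\<close>

lemma (in power_bounded) cinner_Q_kernel_szego:
  assumes r: "0 \<le> r" "r < 1" and w: "norm w < 1" and h: "fourier h = (\<lambda>n. w ^ n)"
  shows "cinner (blinfun_apply (Q_kernel \<rho> r Y) (hardy_tensor x h)) (hardy_tensor x h) =
    cinner h h * cinner (blinfun_apply (K_kernel \<rho> (of_real r * cnj w) Y) x) x"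
proof -
  let ?z = "of_real r * cnj w"
  \<comment> \<open>Deleting the first term of the geometric sequence \<open>w^n\<close> multiplies
    it by \<open>w\<close>.\<close>
  have "hardy_backshift h = w *\<^sub>C h"
    unfolding fourier_inject[symmetric]
    by (simp add: hardy_backshift.rep_eq scaleC_hardy.rep_eq h scaleC_complex_def)
  hence "blinfun_apply (adj unilateral_shift) h = w *\<^sub>C h"
    by (simp add: adj_unilateral_shift bounded_linear_Blinfun_apply[OF bounded_linear_hardy_backshift])
  hence p: "blinfun_apply (op_pow (adj unilateral_shift) k) h = w ^ k *\<^sub>C h" for k
    using clinear_adj[OF clinear_op_unilateral_shift]
    by (induction k) (simp_all add: scaleC_one clinear_op_def scaleC_scaleC mult.commute)
  have 1: "cinner h (blinfun_apply (op_pow unilateral_shift k) h) = w ^ k * cinner h h" for k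
    by (simp add: cinner_op_pow_adj[OF clinear_op_unilateral_shift, symmetric] p cinner_simps)
  have 2: "cinner (blinfun_apply (op_pow unilateral_shift k) h) h = cnj w ^ k * cinner h h" for k
    using 1[of k] by (metis cinner_commute complex_cnj_mult complex_cnj_power)
  have z: "norm ?z < 1"
    using r w mult_strict_mono[of r 1 "norm w" 1] by (simp add: norm_mult)
  have "cinner h h * (\<Sum>k. ?z ^ Suc k * cinner x (blinfun_apply (op_pow Y (Suc k)) x)) =
      (\<Sum>k. of_real (r ^ Suc k) * cinner x (blinfun_apply (op_pow Y (Suc k)) x) *
        (cnj w ^ Suc k * cinner h h))"
    unfolding suminf_mult[OF K_kernel_scalar_summable(1)[OF z], symmetric]
    by (simp only: power_mult_distrib of_real_power mult_ac)
  moreover have "cinner h h * (\<Sum>k. cnj ?z ^ Suc k * cinner (blinfun_apply (op_pow Y (Suc k)) x) x) =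
      (\<Sum>k. of_real (r ^ Suc k) * cinner (blinfun_apply (op_pow Y (Suc k)) x) x *
        (w ^ Suc k * cinner h h))"
    unfolding suminf_mult[OF K_kernel_scalar_summable(2)[OF z], symmetric]
    by (simp only: power_mult_distrib of_real_power mult_ac complex_cnj_mult complex_cnj_cnj
        complex_cnj_complex_of_real)
  ultimately show ?thesis
    unfolding cinner_Q_kernel_tensor[OF r] cinner_K_kernel[OF z] 1 2 distrib_left
    by (simp only: mult_ac)
qed

lemma cinner_kernel_diff:
  "cinner (blinfun_apply (a *\<^sub>R A - B) x) y =
    of_real a * cinner (blinfun_apply A x) y - cinner (blinfun_apply B x) (y :: 'a::complex_inner)"
  by (simp add: blinfun.diff_left blinfun.scaleR_left cinner_simps)

lemma nonneg_Reals_mult_cancel: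
  assumes "of_real s * z \<in> (\<real>\<^sub>\<ge>\<^sub>0 :: complex set)" "s > 0"
  shows "z \<in> \<real>\<^sub>\<ge>\<^sub>0"
  using assms by (auto simp: complex_nonneg_Reals_iff zero_le_mult_iff)

lemma bounded_bilinear_cinner: "bounded_bilinear (cinner :: 'a::complex_inner \<Rightarrow> _)"
proof
  show "\<exists>K. \<forall>a b::'a. norm (cinner a b) \<le> norm a * norm b * K"
    using norm_cinner_le[where 'a='a] by (intro exI[of _ 2]) (simp add: mult_ac)
qed (auto simp: cinner_simps scaleR_conv_of_real)

text \<open>The squared error is a tail of the Parseval series. This density extends positivity from
  vector polynomials to all vectors.\<close>

lemma hardy_partial_sums_tendsto:
  "(\<lambda>N. \<Sum>n<N. hardy_tensor (fourier f n) (hardy_unit n)) \<longlonglongrightarrow> f"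
proof -
  define s where "s N = (\<Sum>n<N. hardy_tensor (fourier f n) (hardy_unit n))" for N
  have c: "fourier (s N) n = (if n < N then fourier f n else 0)" for N n
  proof (induction N)
    case 0 thus ?case by (simp add: s_def zero_hardy.rep_eq)
  next
    case (Suc N)
    have "fourier (s (Suc N)) n = fourier (s N) n + (if n = N then 1 else 0) *\<^sub>C fourier f N"
      by (simp add: s_def plus_hardy.rep_eq hardy_tensor.rep_eq hardy_unit.rep_eq)
    thus ?case
      using Suc scaleC_of_real[of 0 "fourier f N"] by (auto simp: scaleC_one less_Suc_eq)
  qed
  have "(norm (s N - f))\<^sup>2 = (\<Sum>n. (norm (fourier f (n + N)))\<^sup>2)" for N
  proof -
    have "(norm (s N - f))\<^sup>2 = (\<Sum>n. (norm (fourier (s N - f) (n + N)))\<^sup>2) +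
        (\<Sum>n<N. (norm (fourier (s N - f) n))\<^sup>2)"
      unfolding norm_hardy_sq by (rule suminf_split_initial_segment[OF summable_norm_coeff])
    thus ?thesis by (simp add: minus_hardy.rep_eq c)
  qed
  moreover have "(\<lambda>N. \<Sum>n. (norm (fourier f (n + N)))\<^sup>2) \<longlonglongrightarrow> 0"
  proof (rule LIMSEQ_I)
    show "\<exists>M. \<forall>N\<ge>M. norm ((\<Sum>n. (norm (fourier f (n + N)))\<^sup>2) - 0) < e" if "e > 0" for e
      using suminf_exist_split[OF that summable_norm_coeff[of f]] by simp
  qed
  ultimately have "(\<lambda>N. (norm (s N - f))\<^sup>2) \<longlonglongrightarrow> 0" by simp
  hence "(\<lambda>N. sqrt ((norm (s N - f))\<^sup>2)) \<longlonglongrightarrow> sqrt 0" by (rule tendsto_real_sqrt)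
  hence "(\<lambda>N. norm (s N - f)) \<longlonglongrightarrow> 0" by simp
  hence "s \<longlonglongrightarrow> f" by (rule LIM_zero_cancel[OF tendsto_norm_zero_cancel])
  thus ?thesis unfolding s_def .
qed

section \<open>Comparison of Q and K for a pair of operators\<close>

text \<open>\<open>a\<close> stands for the square of the Harnack constant.\<close>

locale power_bounded_pair = Y: power_bounded Y C + Y': power_bounded Y' C'
  for Y Y' :: "'a::chilbert_space \<Rightarrow>\<^sub>L 'a" and C C' :: real +
  fixes \<rho> a :: real
begin

lemma K_kernel_le_of_Q_kernel_le:
  assumes Q: "\<And>r. 0 \<le> r \<Longrightarrow> r < 1 \<Longrightarrow> op_le (Q_kernel \<rho> r Y) (a *\<^sub>R Q_kernel \<rho> r Y')"
    and z: "norm z < 1"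
  shows "op_le (K_kernel \<rho> z Y) (a *\<^sub>R K_kernel \<rho> z Y')"
  unfolding op_le_def op_pos_def
proof
  fix x :: 'a
  \<comment> \<open>The midpoint lies strictly between \<open>norm z\<close> and 1, which puts
    \<open>w\<close> into the disc, and it is positive even for \<open>z = 0\<close>.\<close>
  define r where "r = (1 + norm z) / 2"
  define w where "w = cnj z / of_real r"
  have "0 \<le> r \<and> r < 1 \<and> r > 0 \<and> norm z < r"
    using z norm_ge_zero[of z] unfolding r_def by argo
  hence r: "0 \<le> r" "r < 1" "r > 0" "norm z < r" by auto
  have w: "norm w < 1" and zw: "of_real r * cnj w = z"
    using r by (simp_all add: w_def norm_divide)
  have "summable (\<lambda>n. (norm (w ^ n))\<^sup>2)"
    using w by (simp add: norm_power power_mult[symmetric] mult.commute[of _ 2])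
               (simp add: power_mult power_less_one_iff summable_geometric)
  then obtain h where h: "fourier h = (\<lambda>n. w ^ n)" using Hardy_inverse by blast
  \<comment> \<open>The constant coefficient is \<open>w ^ 0 = 1\<close>, so
    \<open>(norm h)\<^sup>2\<close> can be cancelled later.\<close>
  have "fourier h 0 \<noteq> 0" by (simp add: h)
  hence "h \<noteq> 0" by (auto simp: zero_hardy.rep_eq)
  hence h0: "(norm h)\<^sup>2 > 0" by simp
  let ?f = "hardy_tensor x h"
  have "cinner (blinfun_apply (a *\<^sub>R Q_kernel \<rho> r Y' - Q_kernel \<rho> r Y) ?f) ?f =
      of_real ((norm h)\<^sup>2) * cinner (blinfun_apply (a *\<^sub>R K_kernel \<rho> z Y' - K_kernel \<rho> z Y) x) x"
    unfolding cinner_kernel_diff Y.cinner_Q_kernel_szego[OF r(1,2) w h]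
      Y'.cinner_Q_kernel_szego[OF r(1,2) w h] zw cinner_self
    by (simp add: algebra_simps)
  moreover have "cinner (blinfun_apply (a *\<^sub>R Q_kernel \<rho> r Y' - Q_kernel \<rho> r Y) ?f) ?f \<in> \<real>\<^sub>\<ge>\<^sub>0"
    using Q[OF r(1,2)] unfolding op_le_def op_pos_def by blast
  ultimately have "of_real ((norm h)\<^sup>2) *
      cinner (blinfun_apply (a *\<^sub>R K_kernel \<rho> z Y' - K_kernel \<rho> z Y) x) x \<in> \<real>\<^sub>\<ge>\<^sub>0"
    by simp
  thus "cinner (blinfun_apply (a *\<^sub>R K_kernel \<rho> z Y' - K_kernel \<rho> z Y) x) x \<in> \<real>\<^sub>\<ge>\<^sub>0"
    by (rule nonneg_Reals_mult_cancel[OF _ h0])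
qed

definition kernel_diff :: "real \<Rightarrow> real \<Rightarrow> 'a \<Rightarrow>\<^sub>L 'a" where
  "kernel_diff r t = a *\<^sub>R K_kernel \<rho> (of_real r * cis (2 * pi * t)) Y'
    - K_kernel \<rho> (of_real r * cis (2 * pi * t)) Y"

text \<open>Both the Fourier coefficients of \<open>kernel_diff\<close> and the Toeplitz entries of
  the difference of the Q kernels.\<close>

definition coeff_diff :: "real \<Rightarrow> int \<Rightarrow> 'a \<Rightarrow> 'a \<Rightarrow> complex" where
  "coeff_diff r n x y = of_real a * toeplitz_coeff \<rho> r Y' n x y - toeplitz_coeff \<rho> r Y n x y"

lemma kernel_diff_fourier_coeff:
  assumes "0 \<le> r" "r < 1"
  shows "((\<lambda>t. cis (2 * pi * t) powi l * cinner (blinfun_apply (kernel_diff r t) x) y)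
    has_integral coeff_diff r (- l) x y) {0..1}"
  using has_integral_diff[OF
      has_integral_mult_right[OF Y'.K_kernel_fourier_coeff[OF assms, where \<rho>=\<rho> and l=l and x=x and y=y],
        of "of_real a"]
      Y.K_kernel_fourier_coeff[OF assms, where \<rho>=\<rho> and l=l and x=x and y=y]]
  by (simp add: kernel_diff_def coeff_diff_def cinner_kernel_diff algebra_simps)

lemma norm_circle_less: "0 \<le> r \<Longrightarrow> r < 1 \<Longrightarrow> norm (of_real r * cis (2 * pi * t)) < 1"
  by (simp add: norm_mult)

lemma clinear_op_kernel_diff: "0 \<le> r \<Longrightarrow> r < 1 \<Longrightarrow> clinear_op (kernel_diff r t)"
  unfolding kernel_diff_def
  by (intro clinear_op_diff clinear_op_scaleR Y.clinear_op_K_kernel Y'.clinear_op_K_kernel norm_circle_less)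

lemma Q_kernel_le_of_K_kernel_le:
  assumes K: "\<And>z. norm z < 1 \<Longrightarrow> op_le (K_kernel \<rho> z Y) (a *\<^sub>R K_kernel \<rho> z Y')"
    and r: "0 \<le> r" "r < 1"
  shows "op_le (Q_kernel \<rho> r Y) (a *\<^sub>R Q_kernel \<rho> r Y')"
proof -
  define D where "D = a *\<^sub>R Q_kernel \<rho> r Y' - Q_kernel \<rho> r Y"
  have fin: "cinner (blinfun_apply D f) f \<in> \<real>\<^sub>\<ge>\<^sub>0"
    if f: "f = (\<Sum>n<N. hardy_tensor (x n) (hardy_unit n))" for f N and x :: "nat \<Rightarrow> 'a"
  proof (rule has_integral_nonneg_Reals)
    let ?g = "\<lambda>t. \<Sum>j<N. \<Sum>i<N. cis (2 * pi * t) powi (int j - int i) *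
        cinner (blinfun_apply (kernel_diff r t) (x j)) (x i)"
    have "cinner (blinfun_apply D f) f = (\<Sum>j<N. \<Sum>i<N. coeff_diff r (- (int j - int i)) (x j) (x i))"
      unfolding f blinfun.sum_right cinner_sum_left cinner_sum_right D_def cinner_kernel_diff
        coeff_diff_def Y.cinner_Q_kernel_unit[OF r] Y'.cinner_Q_kernel_unit[OF r]
      by (subst sum.swap) simp
    thus "(?g has_integral cinner (blinfun_apply D f) f) {0..1}"
      by (simp only:) (intro has_integral_sum kernel_diff_fourier_coeff r finite_lessThan)
    fix t :: real
    define c where "c = cis (2 * pi * t)"
    have c: "cnj c = inverse c" "c \<noteq> 0" by (simp_all add: c_def cis_cnj)
    \<comment> \<open>\<open>F\<close> is the value at \<open>c\<close> of the vector polynomial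
      with coefficients \<open>x j\<close>; the exponent \<open>j - i\<close> comes from
      \<open>c^j\<close> and the conjugate of \<open>c^i\<close>.\<close>
    define F where "F = (\<Sum>j<N. (c powi int j) *\<^sub>C x j)"
    have "cinner (blinfun_apply (kernel_diff r t) F) F = (\<Sum>j<N. \<Sum>i<N. c powi int j *
        cnj (c powi int i) * cinner (blinfun_apply (kernel_diff r t) (x j)) (x i))"
      using clinear_op_kernel_diff[OF r, of t]
      by (subst sum.swap) (simp add: F_def blinfun.sum_right cinner_sum_left cinner_sum_right
          cinner_simps clinear_op_def sum_distrib_left mult_ac)
    also have "\<dots> = ?g t"
      unfolding c_def[symmetric] by (simp add: power_int_diff c field_simps)
    finally have "?g t = cinner (blinfun_apply (kernel_diff r t) F) F" ..
    also have "\<dots> \<in> \<real>\<^sub>\<ge>\<^sub>0"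
      using K[OF norm_circle_less[OF r]] by (simp add: op_le_def op_pos_def kernel_diff_def)
    finally show "?g t \<in> \<real>\<^sub>\<ge>\<^sub>0" .
  qed
  \<comment> \<open>Continuity of the form and closedness of the nonnegative reals pass from
    polynomials to the limit.\<close>
  have "cinner (blinfun_apply D f) f \<in> \<real>\<^sub>\<ge>\<^sub>0" for f
  proof (rule Lim_in_closed_set[OF closed_nonneg_Reals_complex])
    let ?s = "\<lambda>N. \<Sum>n<N. hardy_tensor (fourier f n) (hardy_unit n)"
    show "(\<lambda>N. cinner (blinfun_apply D (?s N)) (?s N)) \<longlonglongrightarrow> cinner (blinfun_apply D f) f"
      by (intro bounded_bilinear.tendsto[OF bounded_bilinear_cinner] blinfun.tendsto tendsto_const
          hardy_partial_sums_tendsto)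
    show "\<forall>\<^sub>F N in sequentially. cinner (blinfun_apply D (?s N)) (?s N) \<in> \<real>\<^sub>\<ge>\<^sub>0"
      using fin by simp
  qed simp
  thus ?thesis by (simp add: op_le_def op_pos_def D_def)
qed

end


section \<open>Polynomials\<close>

lemma add_cnj_nonneg: "0 \<le> Re s \<Longrightarrow> s + cnj s \<in> \<real>\<^sub>\<ge>\<^sub>0"
  by (simp add: complex_nonneg_Reals_iff)

text \<open>Twice the Hermitian part of \<open>p\<close> is positive semidefinite by hypothesis; as
  \<open>G\<close> is Hermitian, its Schur sum with \<open>G\<close> is twice the real part of the
  sum for \<open>p\<close>.\<close>

lemma re_schur_product_nonneg:
  assumes fin: "finite S" and G: "psd_on S G"
    and p: "\<And>v. 0 \<le> Re (\<Sum>i\<in>S. \<Sum>j\<in>S. cnj (v i) * p i j * v j)"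
  shows "0 \<le> Re (\<Sum>i\<in>S. \<Sum>j\<in>S. p i j * G i j)"
proof -
  define P where "P i j = p i j + cnj (p j i)" for i j
  have "psd_on S P"
    unfolding psd_on_def
  proof
    fix v
    let ?s = "\<Sum>i\<in>S. \<Sum>j\<in>S. cnj (v i) * p i j * v j"
    have "cnj ?s = (\<Sum>i\<in>S. \<Sum>j\<in>S. cnj (v i) * cnj (p j i) * v j)"
      by (subst sum.swap) (simp add: mult_ac)
    hence "(\<Sum>i\<in>S. \<Sum>j\<in>S. cnj (v i) * P i j * v j) = ?s + cnj ?s"
      by (simp add: P_def algebra_simps sum.distrib)
    thus "(\<Sum>i\<in>S. \<Sum>j\<in>S. cnj (v i) * P i j * v j) \<in> \<real>\<^sub>\<ge>\<^sub>0"
      using add_cnj_nonneg[OF p[of v]] by (simp only:)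
  qed
  hence "(\<Sum>i\<in>S. \<Sum>j\<in>S. P i j * G i j) \<in> \<real>\<^sub>\<ge>\<^sub>0"
    by (rule schur_product_nonneg[OF fin _ G])
  moreover have "(\<Sum>i\<in>S. \<Sum>j\<in>S. P i j * G i j) =
      (\<Sum>i\<in>S. \<Sum>j\<in>S. p i j * G i j) + cnj (\<Sum>i\<in>S. \<Sum>j\<in>S. p i j * G i j)"
  proof -
    have "cnj (\<Sum>i\<in>S. \<Sum>j\<in>S. p i j * G i j) = (\<Sum>i\<in>S. \<Sum>j\<in>S. cnj (p j i) * G i j)"
      by (subst sum.swap) (simp add: psd_on_hermitian[OF G _ _ fin, symmetric])
    thus ?thesis by (simp add: P_def algebra_simps sum.distrib)
  qed
  ultimately show ?thesis by (simp add: complex_nonneg_Reals_iff)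
qed

text \<open>Replacing \<open>X^k\<close> by these forms turns \<open>Re p(X)\<close> into the form of \<open>Re p(Y) + (\<rho> - 1) Re p(0)\<close>.\<close>

definition pow_form :: "real \<Rightarrow> ('a::chilbert_space \<Rightarrow>\<^sub>L 'a) \<Rightarrow> nat \<Rightarrow> 'a \<Rightarrow> 'a \<Rightarrow> complex" where
  "pow_form \<rho> Y k x y = of_real (if k = 0 then \<rho> else 1) * cinner (blinfun_apply (op_pow Y k) x) y"

lemma toeplitz_coeff_minus: "toeplitz_coeff \<rho> r Y (- int k) x y = of_real (r ^ k) * pow_form \<rho> Y k x y"
  by (simp add: toeplitz_coeff_def pow_form_def)

text \<open>For equal arguments the two series are conjugate to each other.\<close>

lemma (in power_bounded) cinner_K_kernel_self:
  assumes z: "norm z < 1"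
  shows "cinner (blinfun_apply (K_kernel \<rho> z Y) x) x =
    of_real (\<rho> * (norm x)\<^sup>2 + 2 * Re (\<Sum>k. cnj z ^ Suc k * pow_form \<rho> Y (Suc k) x x))"
proof -
  let ?f = "\<lambda>k. cnj z ^ Suc k * cinner (blinfun_apply (op_pow Y (Suc k)) x) x"
  have "cnj (\<Sum>k. ?f k) = (\<Sum>k. cnj (?f k))"
    by (rule bounded_linear.suminf[OF bounded_linear_cnj K_kernel_scalar_summable(2)[OF z]])
  also have "\<dots> = (\<Sum>k. z ^ Suc k * cinner x (blinfun_apply (op_pow Y (Suc k)) x))"
    by (simp only: complex_cnj_mult complex_cnj_power complex_cnj_cnj cinner_commute[symmetric])
  finally show ?thesis
    unfolding cinner_K_kernel[OF z] pow_form_def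
    by (simp add: cinner_self complex_eq_iff del: op_pow.simps power_Suc)
qed

section \<open>From the kernel inequality to matrix polynomials\<close>

context power_bounded_pair
begin

abbreviation pow_diff :: "nat \<Rightarrow> 'a \<Rightarrow> 'a \<Rightarrow> complex" where
  "pow_diff k x y \<equiv> of_real a * pow_form \<rho> Y' k x y - pow_form \<rho> Y k x y"

text \<open>Orthogonality on the circle pairs the coefficient of \<open>\<zeta>^k\<close> in the
  polynomial with the kernel coefficient of index \<open>- k\<close>. A radius \<open>r < 1\<close>
  keeps the kernel series convergent and is removed by a limit.\<close>

lemma pow_diff_nonneg_of_K_kernel_le:
  fixes M :: "nat \<Rightarrow> nat \<Rightarrow> nat \<Rightarrow> complex"
  assumes K: "\<And>z. norm z < 1 \<Longrightarrow> op_le (K_kernel \<rho> z Y) (a *\<^sub>R K_kernel \<rho> z Y')"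
    and M: "\<And>z v. norm z < 1 \<Longrightarrow>
      0 \<le> Re (\<Sum>i<m. \<Sum>j<m. cnj (v i) * (\<Sum>k\<le>d. M k i j * z ^ k) * v j)"
  shows "0 \<le> Re (\<Sum>i<m. \<Sum>j<m. \<Sum>k\<le>d. M k i j * pow_diff k (x j) (x i))"
proof -
  \<comment> \<open>The factor \<open>r^k\<close> occurs twice: once from the polynomial at
    \<open>r \<zeta>\<close>, once from the kernel coefficient.\<close>
  define L where "L r = (\<Sum>i<m. \<Sum>j<m. \<Sum>k\<le>d. M k i j * of_real (r ^ k) *
    (of_real (r ^ k) * pow_diff k (x j) (x i)))" for r
  have L: "0 \<le> Re (L r)" if r: "0 \<le> r" "r < 1" for r
  proof -
    define p where "p t i j = (\<Sum>k\<le>d. M k i j * (of_real r * cis (2 * pi * t)) ^ k)" for t i j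
    let ?g = "\<lambda>t. \<Sum>i<m. \<Sum>j<m. p t i j * cinner (blinfun_apply (kernel_diff r t) (x j)) (x i)"
    have g: "?g t = (\<Sum>i<m. \<Sum>j<m. \<Sum>k\<le>d. M k i j * of_real (r ^ k) *
        (cis (2 * pi * t) powi int k * cinner (blinfun_apply (kernel_diff r t) (x j)) (x i)))" for t
      by (simp add: p_def sum_distrib_right power_mult_distrib mult.assoc)
    have "(?g has_integral (\<Sum>i<m. \<Sum>j<m. \<Sum>k\<le>d. M k i j * of_real (r ^ k) *
        coeff_diff r (- int k) (x j) (x i))) {0..1}"
      unfolding g
      by (intro has_integral_sum has_integral_mult_right kernel_diff_fourier_coeff r) auto
    also have "(\<Sum>i<m. \<Sum>j<m. \<Sum>k\<le>d. M k i j * of_real (r ^ k) *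
        coeff_diff r (- int k) (x j) (x i)) = L r"
      by (simp add: L_def coeff_diff_def toeplitz_coeff_minus algebra_simps)
    finally have "(?g has_integral L r) {0..1}" .
    hence "((\<lambda>t. Re (?g t)) has_integral Re (L r)) {0..1}"
      by (rule has_integral_linear[OF _ bounded_linear_Re, unfolded o_def])
    moreover have "0 \<le> Re (?g t)" for t
    proof (rule re_schur_product_nonneg)
      show "psd_on {..<m} (\<lambda>i j. cinner (blinfun_apply (kernel_diff r t) (x j)) (x i))"
        unfolding psd_on_def
      proof
        fix v :: "nat \<Rightarrow> complex"
        define F where "F = (\<Sum>j<m. v j *\<^sub>C x j)"
        have "cinner (blinfun_apply (kernel_diff r t) F) F =
            (\<Sum>i<m. \<Sum>j<m. cnj (v i) * cinner (blinfun_apply (kernel_diff r t) (x j)) (x i) * v j)"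
          using clinear_op_kernel_diff[OF r, of t]
          by (simp add: F_def blinfun.sum_right cinner_sum_left cinner_sum_right
              cinner_simps clinear_op_def sum_distrib_left mult_ac)
        moreover have "cinner (blinfun_apply (kernel_diff r t) F) F \<in> \<real>\<^sub>\<ge>\<^sub>0"
          using K[OF norm_circle_less[OF r]] by (simp add: op_le_def op_pos_def kernel_diff_def)
        ultimately show "(\<Sum>i<m. \<Sum>j<m. cnj (v i) *
            cinner (blinfun_apply (kernel_diff r t) (x j)) (x i) * v j) \<in> \<real>\<^sub>\<ge>\<^sub>0"
          by simp
      qed
      show "0 \<le> Re (\<Sum>i<m. \<Sum>j<m. cnj (v i) * p t i j * v j)" for v
        unfolding p_def by (rule M[OF norm_circle_less[OF r]])
    qed simp
    ultimately show ?thesis using has_integral_nonneg by blast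
  qed
  \<comment> \<open>\<open>L\<close> is a polynomial in \<open>r\<close>, so its left limit at 1 is
    its value there.\<close>
  have "((\<lambda>r. Re (L r)) \<longlongrightarrow> Re (L 1)) (at_left 1)"
    unfolding L_def by (intro tendsto_intros)
  moreover have "\<forall>\<^sub>F r in at_left 1. 0 \<le> Re (L r)"
  proof -
    have "(0::real) < 1" by simp
    from eventually_at_left_real[OF this] show ?thesis
      by (rule eventually_mono) (use L in auto)
  qed
  ultimately have "0 \<le> Re (L 1)"
    by (intro tendsto_lowerbound[of "\<lambda>r. Re (L r)"]) auto
  thus ?thesis by (simp add: L_def)
qed

end

section \<open>Truncated Poisson kernels and the way back to K\<close>

text \<open>Degree \<open>d\<close> truncation of
  \<open>1 + 2 \<Sum> cnj z^k X^k = (1 + W) (1 - W)^(-1)\<close> with \<open>W = cnj z X\<close>,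
  whose real part is nonnegative for contractions; the constant term is raised by an amount
  vanishing as \<open>d\<close> grows.\<close>

definition poisson_coeff :: "complex \<Rightarrow> nat \<Rightarrow> nat \<Rightarrow> complex" where
  "poisson_coeff z d k = (if k = 0 then of_real (1 + norm z ^ Suc d * (2 / (1 - norm z) + 1))
    else 2 * cnj z ^ k)"

text \<open>With \<open>W = cnj z X\<close> and \<open>y = (1 + W + \<dots> + W^d) u\<close> one has \<open>u = y - W y + e\<close>, where
  \<open>e = W^(d+1) u\<close>, hence \<open>2 Re \<langle>y, u\<rangle> - |u|^2 = |y|^2 - |W y|^2 + 2 Re \<langle>W y, e\<rangle> - |e|^2\<close>;
  the constant coefficient of \<^const>\<open>poisson_coeff\<close> absorbs the terms in \<open>e\<close>.\<close>

lemma poisson_coeff_nonneg: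
  fixes X :: "'k::chilbert_space \<Rightarrow>\<^sub>L 'k"
  assumes X: "clinear_op X" "norm X < 1" and z: "norm z < 1"
  shows "0 \<le> Re (\<Sum>k\<le>d. poisson_coeff z d k * cinner (blinfun_apply (op_pow X k) u) u)"
proof -
  define s where "s = norm z"
  have s: "0 \<le> s" "s < 1" using z by (auto simp: s_def)
  define w where "w k = (cnj z ^ k) *\<^sub>C blinfun_apply (op_pow X k) u" for k
  define y where "y = (\<Sum>k\<le>d. w k)"
  define v where "v = cnj z *\<^sub>C blinfun_apply X y"
  define e where "e = w (Suc d)"
  have Xle: "norm (blinfun_apply (op_pow X k) u) \<le> norm u" for k
    using norm_blinfun[of "op_pow X k" u] norm_op_pow_le_one[of X k] X(2)
      mult_right_mono[of "norm (op_pow X k)" 1 "norm u"] by simp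
  have wle: "norm (w k) \<le> s ^ k * norm u" for k
    by (simp add: w_def norm_scaleC norm_power s_def mult_left_mono Xle)
  have w_Suc: "cnj z *\<^sub>C blinfun_apply X (w k) = w (Suc k)" for k
    using X(1) by (simp add: w_def clinear_op_def scaleC_scaleC)
  have "v = (\<Sum>k\<le>d. w (Suc k))"
    unfolding v_def y_def blinfun.sum_right w_Suc[symmetric]
    by (rule linear_sum[OF bounded_linear.linear[OF bounded_linear_scaleC]])
  hence "y - v = w 0 - w (Suc d)"
    unfolding y_def using sum_telescope[of w d] by (simp add: sum_subtractf)
  hence u: "u = y - v + e"
    by (simp add: w_def[of 0] e_def scaleC_one algebra_simps)
  have "norm y \<le> (\<Sum>k\<le>d. s ^ k * norm u)"
    unfolding y_def by (rule sum_norm_le) (rule wle)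
  also have "\<dots> = (\<Sum>k\<le>d. s ^ k) * norm u" by (simp add: sum_distrib_right)
  also have "\<dots> \<le> 1 / (1 - s) * norm u"
    using s by (intro mult_right_mono) (simp_all add: sum_gp0 divide_right_mono)
  finally have y: "norm y \<le> norm u / (1 - s)" by simp
  have vy: "norm v \<le> norm y"
  proof -
    have "norm v = s * norm (blinfun_apply X y)" by (simp add: v_def norm_scaleC s_def)
    also have "\<dots> \<le> 1 * (1 * norm y)"
      using s X(2) norm_blinfun[of X y] mult_right_mono[of "norm X" 1 "norm y"]
      by (intro mult_mono) auto
    finally show ?thesis by simp
  qed
  have e: "norm e \<le> s ^ Suc d * norm u" unfolding e_def by (rule wle)
  \<comment> \<open>The square of \<open>s ^ Suc d\<close> is weakened to \<open>s ^ Suc d\<close>,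
    so that both error terms carry the same factor.\<close>
  have e2: "(norm e)\<^sup>2 \<le> s ^ Suc d * (norm u)\<^sup>2"
  proof -
    have "(norm e)\<^sup>2 \<le> (s ^ Suc d * norm u)\<^sup>2" using e by (rule power_mono) simp
    also have "\<dots> = s ^ Suc d * (s ^ Suc d * (norm u)\<^sup>2)" by (simp add: power2_eq_square)
    also have "\<dots> \<le> s ^ Suc d * (1 * (norm u)\<^sup>2)"
      using s power_le_one[of s "Suc d"] by (intro mult_left_mono mult_right_mono) auto
    finally show ?thesis by simp
  qed
  \<comment> \<open>The geometric bound on \<open>norm y\<close> is the source of
    \<open>2 / (1 - s)\<close> in the constant coefficient.\<close>
  have ve: "- inner v e \<le> s ^ Suc d * (norm u)\<^sup>2 / (1 - s)"
  proof -
    have "- inner v e \<le> norm v * norm e" using norm_cauchy_schwarz[of "- v" e] by simp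
    also have "\<dots> \<le> (norm u / (1 - s)) * (s ^ Suc d * norm u)"
      using vy y e s by (intro mult_mono) auto
    finally show ?thesis by (simp add: power2_eq_square mult_ac)
  qed
  have "2 * inner y u - (norm u)\<^sup>2 = (norm y)\<^sup>2 - (norm v)\<^sup>2 + 2 * inner v e - (norm e)\<^sup>2"
    unfolding u power2_norm_eq_inner
    by (simp add: inner_add_left inner_add_right inner_diff_left inner_diff_right
        inner_commute[of v y] inner_commute[of e y] inner_commute[of e v])
  moreover have "(norm v)\<^sup>2 \<le> (norm y)\<^sup>2" using vy by (rule power_mono) simp
  ultimately have "2 * inner y u - (norm u)\<^sup>2 \<ge>
      - (2 * (s ^ Suc d * (norm u)\<^sup>2 / (1 - s)) + s ^ Suc d * (norm u)\<^sup>2)"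
    using ve e2 by linarith
  also have "2 * (s ^ Suc d * (norm u)\<^sup>2 / (1 - s)) + s ^ Suc d * (norm u)\<^sup>2 =
      s ^ Suc d * (2 / (1 - s) + 1) * (norm u)\<^sup>2"
    by (simp add: algebra_simps)
  finally have main: "0 \<le> 2 * inner y u - (norm u)\<^sup>2 + s ^ Suc d * (2 / (1 - s) + 1) * (norm u)\<^sup>2"
    by simp
  \<comment> \<open>The constant coefficient \<open>1 + \<epsilon>\<close> is split as
    \<open>2 + (\<epsilon> - 1)\<close>, which makes the factor 2 uniform in
    \<open>k\<close>.\<close>
  have "(\<Sum>k\<le>d. poisson_coeff z d k * cinner (blinfun_apply (op_pow X k) u) u) =
      (\<Sum>k\<le>d. 2 * cinner (w k) u + (if k = 0 then
        of_real (s ^ Suc d * (2 / (1 - s) + 1) - 1) * cinner u u else 0))"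
    by (intro sum.cong refl)
       (simp add: poisson_coeff_def w_def cinner_simps scaleC_one s_def algebra_simps)
  also have "\<dots> = 2 * cinner y u + of_real (s ^ Suc d * (2 / (1 - s) + 1) - 1) * cinner u u"
    by (simp add: sum.distrib y_def cinner_sum_left sum_distrib_left)
  finally have "Re (\<Sum>k\<le>d. poisson_coeff z d k * cinner (blinfun_apply (op_pow X k) u) u) =
      2 * inner y u + (s ^ Suc d * (2 / (1 - s) + 1) - 1) * (norm u)\<^sup>2"
    by (simp add: cinner_self Re_cinner)
  thus ?thesis using main by (simp add: algebra_simps)
qed

context power_bounded_pair
begin

text \<open>As \<open>d\<close> grows, the correction of the constant coefficient vanishes and the
  truncations converge to a series whose real part is the form of
  \<open>a K(z, Y') - K(z, Y)\<close> at \<open>x\<close>.\<close>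

lemma K_kernel_le_of_pow_diff_nonneg:
  assumes z: "norm z < 1"
    and P: "\<And>d x. 0 \<le> Re (\<Sum>k\<le>d. poisson_coeff z d k * pow_diff k x x)"
  shows "op_le (K_kernel \<rho> z Y) (a *\<^sub>R K_kernel \<rho> z Y')"
  unfolding op_le_def op_pos_def
proof
  fix x :: 'a
  let ?e = "\<lambda>d. norm z ^ Suc d * (2 / (1 - norm z) + 1)"
  let ?f = "\<lambda>(Y :: 'a \<Rightarrow>\<^sub>L 'a) k. cnj z ^ Suc k * pow_form \<rho> Y (Suc k) x x"
  have s: "summable (?f Y)" "summable (?f Y')"
    using Y.K_kernel_scalar_summable(2)[OF z, of x x] Y'.K_kernel_scalar_summable(2)[OF z, of x x]
    by (simp_all add: pow_form_def del: op_pow.simps power_Suc)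
  define S where "S = of_real a * (\<Sum>k. ?f Y' k) - (\<Sum>k. ?f Y k)"
  have "(\<lambda>d. \<Sum>k<d. of_real a * ?f Y' k - ?f Y k) \<longlonglongrightarrow> S"
    unfolding S_def sum_subtractf sum_distrib_left[symmetric]
    by (intro tendsto_intros summable_LIMSEQ s)
  moreover have "?e \<longlonglongrightarrow> 0"
    using LIMSEQ_Suc[OF LIMSEQ_power_zero[of "norm z"]] z by (intro tendsto_mult_left_zero) simp
  ultimately have "(\<lambda>d. of_real (1 + ?e d) * pow_diff 0 x x +
      2 * (\<Sum>k<d. of_real a * ?f Y' k - ?f Y k)) \<longlonglongrightarrow> of_real (1 + 0) * pow_diff 0 x x + 2 * S"
    by (intro tendsto_intros)
  moreover have "of_real (1 + ?e d) * pow_diff 0 x x + 2 * (\<Sum>k<d. of_real a * ?f Y' k - ?f Y k) =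
      (\<Sum>k\<le>d. poisson_coeff z d k * pow_diff k x x)" for d
  proof -
    \<comment> \<open>The sum over \<open>k \<le> d\<close> is its constant term plus
      \<open>d\<close> terms of index \<open>Suc k\<close>, matching the partial sums over
      \<open>k < d\<close>.\<close>
    have "poisson_coeff z d 0 = of_real (1 + ?e d)" "poisson_coeff z d (Suc k) = 2 * cnj z ^ Suc k" for k
      by (simp_all add: poisson_coeff_def)
    thus ?thesis
      by (simp only: sum.atMost_shift sum_distrib_left right_diff_distrib left_diff_distrib mult_ac)
  qed
  ultimately have "(\<lambda>d. Re (\<Sum>k\<le>d. poisson_coeff z d k * pow_diff k x x)) \<longlonglongrightarrow>
      Re (of_real (1 + 0) * pow_diff 0 x x + 2 * S)"
    by (intro tendsto_Re) (simp only:)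
  hence "0 \<le> Re (of_real (1 + 0) * pow_diff 0 x x + 2 * S)"
    by (rule tendsto_lowerbound) (intro always_eventually allI P, simp)
  also have "\<dots> = a * (\<rho> * (norm x)\<^sup>2 + 2 * Re (\<Sum>k. ?f Y' k)) - (\<rho> * (norm x)\<^sup>2 + 2 * Re (\<Sum>k. ?f Y k))"
    by (simp add: S_def pow_form_def[of _ _ 0] cinner_self algebra_simps)
  finally show "cinner (blinfun_apply (a *\<^sub>R K_kernel \<rho> z Y' - K_kernel \<rho> z Y) x) x \<in> \<real>\<^sub>\<ge>\<^sub>0"
    by (simp add: cinner_kernel_diff Y.cinner_K_kernel_self[OF z] Y'.cinner_K_kernel_self[OF z]
        complex_nonneg_Reals_iff del: op_pow.simps power_Suc)
qed

end


section \<open>Harnack domination\<close>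

text \<open>The size is an argument, so that sums and multiples of matrices share one index
  range.\<close>

definition block_form :: "nat \<Rightarrow> ('a::chilbert_space \<Rightarrow>\<^sub>L 'a) mat \<Rightarrow> (nat \<Rightarrow> 'a) \<Rightarrow> complex" where
  "block_form m A x = (\<Sum>i<m. \<Sum>j<m. cinner (blinfun_apply (A $$ (i, j)) (x j)) (x i))"

lemma block_pos_iff:
  "A \<in> carrier_mat m m \<Longrightarrow> block_pos A \<longleftrightarrow> (\<forall>x. block_form m A x \<in> \<real>\<^sub>\<ge>\<^sub>0)"
  by (auto simp: block_pos_def block_form_def)

lemma block_form_add:
  assumes "A \<in> carrier_mat m m" "B \<in> carrier_mat m m"
  shows "block_form m (A + B) x = block_form m A x + block_form m B x"
  using assms by (simp add: block_form_def blinfun.add_left cinner_simps sum.distrib)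

lemma block_form_diff:
  assumes "A \<in> carrier_mat m m" "B \<in> carrier_mat m m"
  shows "block_form m (A - B) x = block_form m A x - block_form m B x"
  using assms by (simp add: block_form_def blinfun.diff_left cinner_simps sum_subtractf)

lemma block_form_scaleR:
  assumes "A \<in> carrier_mat m m"
  shows "block_form m (block_scaleR r A) x = of_real r * block_form m A x"
  using assms
  by (simp add: block_form_def block_scaleR_def blinfun.scaleR_left cinner_simps sum_distrib_left)

lemma block_scaleR_carrier: "A \<in> carrier_mat m m \<Longrightarrow> block_scaleR r A \<in> carrier_mat m m"
  by (simp add: block_scaleR_def)

lemma block_adj_carrier: "A \<in> carrier_mat m m \<Longrightarrow> block_adj A \<in> carrier_mat m m"
  unfolding block_adj_def by (frule carrier_matD(1), drule carrier_matD(2)) simp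

lemma block_Re_carrier: "A \<in> carrier_mat m m \<Longrightarrow> block_Re A \<in> carrier_mat m m"
  unfolding block_Re_def by (intro block_scaleR_carrier add_carrier_mat)

text \<open>The form of the block adjoint is the conjugate of the form of \<open>A\<close>, so
  averaging the two leaves the real part.\<close>

lemma block_form_Re:
  assumes A: "A \<in> carrier_mat m m"
    and cl: "\<And>i j. i < m \<Longrightarrow> j < m \<Longrightarrow> clinear_op (A $$ (i, j))"
  shows "block_form m (block_Re A) x = of_real (Re (block_form m A x))"
proof -
  have "block_form m (block_adj A) x = (\<Sum>i<m. \<Sum>j<m. cinner (x j) (blinfun_apply (A $$ (j, i)) (x i)))"
    using carrier_matD[OF A]
    by (auto simp: block_form_def block_adj_def cinner_adj' cl intro!: sum.cong)
  also have "\<dots> = cnj (block_form m A x)"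
    unfolding block_form_def
    by (subst sum.swap) (simp add: cinner_commute[of "x _"])
  finally show ?thesis
    using A by (simp add: block_Re_def block_form_scaleR block_form_add block_adj_carrier complex_eq_iff)
qed

section \<open>Forms of matrix polynomials\<close>

lemma mpoly_op_carrier: "mpoly_op m d M T \<in> carrier_mat m m"
  by (simp add: mpoly_op_def)

lemma clinear_op_zero: "clinear_op (0 :: 'a::chilbert_space \<Rightarrow>\<^sub>L 'a)"
  using clinear_op_scaleR[OF clinear_op_id, of 0] by simp

lemma clinear_op_sum:
  fixes A :: "_ \<Rightarrow> 'a::chilbert_space \<Rightarrow>\<^sub>L 'a"
  shows "(\<And>k. k \<in> S \<Longrightarrow> clinear_op (A k)) \<Longrightarrow> clinear_op (\<Sum>k\<in>S. A k)"
  by (induction S rule: infinite_finite_induct)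
     (auto intro: clinear_op_add clinear_op_zero)

lemma clinear_op_mpoly:
  assumes "clinear_op T" "i < m" "j < m" shows "clinear_op (mpoly_op m d M T $$ (i, j))"
  using assms by (auto simp: mpoly_op_def intro!: clinear_op_sum clinear_op_scaleC clinear_op_pow)

lemma block_form_mpoly:
  "block_form m (mpoly_op m d M T) x =
    (\<Sum>i<m. \<Sum>j<m. \<Sum>k\<le>d. M k $$ (i, j) * cinner (blinfun_apply (op_pow T k) (x j)) (x i))"
  by (simp add: block_form_def mpoly_op_def blinfun.sum_left cinner_sum_left scaleC_blinfun.rep_eq
      cinner_simps)

lemma Re_pos_mpoly_iff:
  "Re_pos_mpoly TYPE('k::chilbert_space) m d M \<longleftrightarrow>
    (\<forall>(X :: 'k::chilbert_space \<Rightarrow>\<^sub>L 'k) x. clinear_op X \<and> norm X < 1 \<longrightarrow> 0 \<le> Re (block_form m (mpoly_op m d M X) x))"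
  by (auto simp: Re_pos_mpoly_def block_pos_iff[OF block_Re_carrier[OF mpoly_op_carrier]]
      block_form_Re[OF mpoly_op_carrier clinear_op_mpoly])

lemma op_pow_zero: "op_pow (0 :: 'a::real_normed_vector \<Rightarrow>\<^sub>L 'a) k = (if k = 0 then id_blinfun else 0)"
  by (induction k) auto

text \<open>The only nonzero power of the zero operator is \<open>0^0 = I\<close>, so
  \<open>p(0)\<close> is the constant term, and adding \<open>(\<rho> - 1) p(0)\<close> changes the
  weight of \<open>k = 0\<close> from 1 to \<open>\<rho>\<close>.\<close>

lemma dilation_form:
  "Re (block_form m (mpoly_op m d M T) x) + (\<rho> - 1) * Re (block_form m (mpoly_op m d M 0) x) =
    Re (\<Sum>i<m. \<Sum>j<m. \<Sum>k\<le>d. M k $$ (i, j) * pow_form \<rho> T k (x j) (x i))"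
proof -
  have 0: "of_real (\<rho> - 1) * block_form m (mpoly_op m d M 0) x =
      (\<Sum>i<m. \<Sum>j<m. \<Sum>k\<le>d. M k $$ (i, j) *
        (of_real (if k = 0 then \<rho> - 1 else 0) * cinner (blinfun_apply (op_pow T k) (x j)) (x i)))"
    unfolding block_form_mpoly sum_distrib_left
    by (intro sum.cong refl) (auto simp: op_pow_zero cinner_simps)
  have "block_form m (mpoly_op m d M T) x + of_real (\<rho> - 1) * block_form m (mpoly_op m d M 0) x =
      (\<Sum>i<m. \<Sum>j<m. \<Sum>k\<le>d. M k $$ (i, j) * pow_form \<rho> T k (x j) (x i))"
    unfolding 0 unfolding block_form_mpoly sum.distrib[symmetric]
    by (intro sum.cong refl) (auto simp: pow_form_def algebra_simps)
  hence "Re (block_form m (mpoly_op m d M T) x + of_real (\<rho> - 1) * block_form m (mpoly_op m d M 0) x) =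
      Re (\<Sum>i<m. \<Sum>j<m. \<Sum>k\<le>d. M k $$ (i, j) * pow_form \<rho> T k (x j) (x i))"
    by (rule arg_cong)
  thus ?thesis by simp
qed

lemma Re_of_real_times: "Re (of_real r * z) = r * Re z"
  by simp

text \<open>Both sides of the block inequality have real forms, given by
  \<open>dilation_form\<close>; domination becomes one real inequality for each admissible
  polynomial and each tuple \<open>x\<close>.\<close>

lemma harnack_dominated_iff:
  assumes T: "clinear_op T" and T': "clinear_op T'"
  shows "harnack_dominated TYPE('k::chilbert_space) \<rho> c T T' \<longleftrightarrow>
    (\<forall>m\<ge>1. \<forall>d M. (\<forall>k\<le>d. M k \<in> carrier_mat m m) \<and> Re_pos_mpoly TYPE('k) m d M \<longrightarrow>
      (\<forall>x. 0 \<le> Re (\<Sum>i<m. \<Sum>j<m. \<Sum>k\<le>d. M k $$ (i, j) *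
        (of_real (c\<^sup>2) * pow_form \<rho> T' k (x j) (x i) - pow_form \<rho> T k (x j) (x i)))))"
proof -
  have "block_le
      (block_Re (mpoly_op m d M T) + block_scaleR (\<rho> - 1) (block_Re (mpoly_op m d M 0)))
      (block_scaleR (c\<^sup>2)
        (block_Re (mpoly_op m d M T') + block_scaleR (\<rho> - 1) (block_Re (mpoly_op m d M 0)))) \<longleftrightarrow>
    (\<forall>x. 0 \<le> Re (\<Sum>i<m. \<Sum>j<m. \<Sum>k\<le>d. M k $$ (i, j) *
        (of_real (c\<^sup>2) * pow_form \<rho> T' k (x j) (x i) - pow_form \<rho> T k (x j) (x i))))"
    (is "block_le ?A (block_scaleR _ ?B) \<longleftrightarrow> _") for m d M
  proof -
    let ?h = "\<lambda>T x. \<Sum>i<m. \<Sum>j<m. \<Sum>k\<le>d. M k $$ (i, j) * pow_form \<rho> T k (x j) (x i)"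
    have f: "block_form m (block_Re (mpoly_op m d M T) +
        block_scaleR (\<rho> - 1) (block_Re (mpoly_op m d M 0))) x = of_real (Re (?h T x))"
      if "clinear_op T" for T x
    proof -
      show ?thesis
        unfolding dilation_form[symmetric]
        by (simp add: block_form_add[OF block_Re_carrier block_scaleR_carrier[OF block_Re_carrier]]
            block_form_scaleR[OF block_Re_carrier] mpoly_op_carrier
            block_form_Re[OF mpoly_op_carrier clinear_op_mpoly] that clinear_op_zero)
    qed
    have cA: "?A \<in> carrier_mat m m" and cB: "?B \<in> carrier_mat m m"
      by (intro add_carrier_mat block_scaleR_carrier block_Re_carrier mpoly_op_carrier)+
    have "block_form m (block_scaleR (c\<^sup>2) ?B - ?A) x = of_real (c\<^sup>2 * Re (?h T' x) - Re (?h T x))" for x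
      unfolding block_form_diff[OF block_scaleR_carrier[OF cB] cA] block_form_scaleR[OF cB]
        f[OF T] f[OF T'] by simp
    moreover have "c\<^sup>2 * Re (?h T' x) - Re (?h T x) = Re (\<Sum>i<m. \<Sum>j<m. \<Sum>k\<le>d. M k $$ (i, j) *
        (of_real (c\<^sup>2) * pow_form \<rho> T' k (x j) (x i) - pow_form \<rho> T k (x j) (x i)))" for x
    proof -
      have "(\<Sum>i<m. \<Sum>j<m. \<Sum>k\<le>d. M k $$ (i, j) *
          (of_real (c\<^sup>2) * pow_form \<rho> T' k (x j) (x i) - pow_form \<rho> T k (x j) (x i))) =
          of_real (c\<^sup>2) * ?h T' x - ?h T x"
        unfolding sum_distrib_left sum_subtractf[symmetric]
        by (intro sum.cong refl) (simp only: right_diff_distrib mult_ac)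
      thus ?thesis by (simp only: minus_complex.sel Re_of_real_times)
    qed
    ultimately show ?thesis
      unfolding block_le_def block_pos_iff[OF minus_carrier_mat[OF cA]]
      by (simp only: nonneg_Reals_of_real_iff)
  qed
  thus ?thesis unfolding harnack_dominated_def by (simp only:)
qed

section \<open>Scalar test operators and the equivalence\<close>

text \<open>Otherwise the empty set would already span the space.\<close>

lemma infinite_dimensional_nontrivial:
  assumes "infinite_dimensional TYPE('k::chilbert_space)"
  obtains u :: "'k::chilbert_space" where "u \<noteq> 0"
proof -
  have "(0 :: 'k) \<in> Modules.module.span (*\<^sub>C) {}"
    by (rule module.span_zero[OF module_scaleC])
  thus thesis
    using assms that unfolding infinite_dimensional_def by (metis UNIV_eq_I finite.emptyI)
qed

text \<open>Take \<open>X = z I\<close> and the vectors \<open>v j u\<close>.\<close>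

lemma Re_pos_mpoly_scalar:
  assumes M: "Re_pos_mpoly TYPE('k::chilbert_space) m d M" and u: "(u :: 'k::chilbert_space) \<noteq> 0" and z: "norm z < 1"
  shows "0 \<le> Re (\<Sum>i<m. \<Sum>j<m. cnj (v i) * (\<Sum>k\<le>d. M k $$ (i, j) * z ^ k) * v j)"
proof -
  define X :: "'k \<Rightarrow>\<^sub>L 'k" where "X = z *\<^sub>C id_blinfun"
  have "norm X \<le> norm z * norm (id_blinfun :: 'k \<Rightarrow>\<^sub>L 'k)" unfolding X_def by (rule norm_scaleC_blinfun_le)
  also have "\<dots> \<le> norm z * 1" by (intro mult_left_mono norm_blinfun_id_le) auto
  finally have X: "clinear_op X" "norm X < 1"
    using z by (auto simp: X_def intro: clinear_op_scaleC clinear_op_id)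
  have p: "blinfun_apply (op_pow X k) x = z ^ k *\<^sub>C x" for k x
    by (induction k) (auto simp: X_def scaleC_blinfun.rep_eq scaleC_one scaleC_scaleC)
  have "block_form m (mpoly_op m d M X) (\<lambda>j. v j *\<^sub>C u) =
      of_real ((norm u)\<^sup>2) * (\<Sum>i<m. \<Sum>j<m. cnj (v i) * (\<Sum>k\<le>d. M k $$ (i, j) * z ^ k) * v j)"
    by (simp add: block_form_mpoly p cinner_simps cinner_self sum_distrib_left sum_distrib_right mult_ac)
  moreover have "0 \<le> Re (block_form m (mpoly_op m d M X) (\<lambda>j. v j *\<^sub>C u))"
    using M X unfolding Re_pos_mpoly_iff by blast
  ultimately have "0 \<le> (norm u)\<^sup>2 *
      Re (\<Sum>i<m. \<Sum>j<m. cnj (v i) * (\<Sum>k\<le>d. M k $$ (i, j) * z ^ k) * v j)"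
    by (simp only: Re_of_real_times)
  thus ?thesis using u by (simp add: zero_le_mult_iff)
qed

theorem proposition7p1:
  fixes \<rho> c :: real and T T' :: "'a::chilbert_space \<Rightarrow>\<^sub>L 'a"
  assumes "\<rho> > 0"
    and "rho_contraction TYPE('g::chilbert_space) \<rho> T"
    and "rho_contraction TYPE('h::chilbert_space) \<rho> T'"
    and "c \<ge> 1"
    and "infinite_dimensional TYPE('k::chilbert_space)"
  shows "(harnack_dominated TYPE('k) \<rho> c T T' \<longleftrightarrow>
            (\<forall>r\<in>{0..<1}. op_le (Q_kernel \<rho> r T) (c\<^sup>2 *\<^sub>R Q_kernel \<rho> r T')))
       \<and> ((\<forall>r\<in>{0..<1}. op_le (Q_kernel \<rho> r T) (c\<^sup>2 *\<^sub>R Q_kernel \<rho> r T')) \<longleftrightarrow>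
            (\<forall>z\<in>ball 0 1. op_le (K_kernel \<rho> z T) (c\<^sup>2 *\<^sub>R K_kernel \<rho> z T')))"
proof -
  have cl: "clinear_op T" "clinear_op T'"
    using assms(2,3) by (auto simp: rho_contraction_def)
  interpret power_bounded_pair T T' "max 1 \<rho>" "max 1 \<rho>" \<rho> "c\<^sup>2"
    by unfold_locales (use cl rho_contraction_power_bounded assms in blast)+
  \<comment> \<open>A nonzero vector turns positivity of \<open>Re p\<close> at multiples of the
    identity into positivity of the scalar matrices \<open>Re p(z)\<close>.\<close>
  obtain u :: 'k where u: "u \<noteq> 0"
    using infinite_dimensional_nontrivial[OF assms(5)] .
  let ?Q = "\<forall>r\<in>{0..<1}. op_le (Q_kernel \<rho> r T) (c\<^sup>2 *\<^sub>R Q_kernel \<rho> r T')"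
  let ?K = "\<forall>z\<in>ball 0 1. op_le (K_kernel \<rho> z T) (c\<^sup>2 *\<^sub>R K_kernel \<rho> z T')"
  have QK: "?Q \<longleftrightarrow> ?K"
    using K_kernel_le_of_Q_kernel_le Q_kernel_le_of_K_kernel_le by auto
  have "harnack_dominated TYPE('k) \<rho> c T T'" if K: ?K
    unfolding harnack_dominated_iff[OF cl]
  proof (intro allI impI)
    fix m d and M :: "nat \<Rightarrow> complex mat" and x :: "nat \<Rightarrow> 'a"
    assume "(\<forall>k\<le>d. M k \<in> carrier_mat m m) \<and> Re_pos_mpoly TYPE('k) m d M"
    thus "0 \<le> Re (\<Sum>i<m. \<Sum>j<m. \<Sum>k\<le>d. M k $$ (i, j) *
        (of_real (c\<^sup>2) * pow_form \<rho> T' k (x j) (x i) - pow_form \<rho> T k (x j) (x i)))"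
      using K Re_pos_mpoly_scalar[OF _ u]
      by (intro pow_diff_nonneg_of_K_kernel_le[where M="\<lambda>k i j. M k $$ (i, j)"]) auto
  qed
  moreover have ?K if H: "harnack_dominated TYPE('k) \<rho> c T T'"
  proof
    fix z :: complex assume "z \<in> ball 0 1"
    hence z: "norm z < 1" by simp
    show "op_le (K_kernel \<rho> z T) (c\<^sup>2 *\<^sub>R K_kernel \<rho> z T')"
    proof (rule K_kernel_le_of_pow_diff_nonneg[OF z])
      fix d x
      \<comment> \<open>The truncated Poisson polynomials, viewed as having one-by-one coefficients,
        are admissible by \<open>poisson_coeff_nonneg\<close>.\<close>
      define M where "M k = mat 1 1 (\<lambda>_. poisson_coeff z d k)" for k
      have "Re_pos_mpoly TYPE('k) 1 d M"
        unfolding Re_pos_mpoly_iff block_form_mpoly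
        by (auto simp: M_def simp del: Re_sum intro!: poisson_coeff_nonneg[OF _ _ z])
      moreover have "\<forall>k\<le>d. M k \<in> carrier_mat 1 1" by (simp add: M_def)
      ultimately have "0 \<le> Re (\<Sum>i<1. \<Sum>j<1. \<Sum>k\<le>d. M k $$ (i, j) * pow_diff k x x)"
        by (intro H[unfolded harnack_dominated_iff[OF cl], rule_format,
            where m=1 and d=d and M=M and x="\<lambda>_. x"] conjI) simp_all
      thus "0 \<le> Re (\<Sum>k\<le>d. poisson_coeff z d k * pow_diff k x x)"
        by (simp add: M_def)
    qed
  qed
  ultimately show ?thesis using QK by blast
qed

end
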